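(* Let $\mathfrak g=\mathfrak{osp}(m|2n)$ with $M=m-2n\notin\{1,2\}$, and let $\lambda\in\mathbb C$ with $\lambda\neq-\frac{M-4}{4(M-1)}$. Then the two-sided ideal $\mathcal J^1_\lambda$ of the tensor algebra $\otimes\mathfrak g=\bigoplus_{k\ge0}\otimes^k\mathfrak g$ generated by the elements $$X\otimes Y-X\circledcirc_1Y-\tfrac12[X,Y]-\lambda\langle X,Y\rangle\in\mathfrak g\otimes\mathfrak g\oplus\mathfrak g\oplus\mathbb C,\qquad X,Y\in\mathfrak g,$$ contains $\mathfrak g=\otimes^1\mathfrak g$.
   Context: Conventions: $\mathbb C^{m|2n}$ with parity $[a]=0$ for $a\le m$, $[a]=1$ otherwise; orthosymplectic metric $g_{ab}$ (invertible, $g_{ab}=0$ if $[a]\ne[b]$, $g_{ba}=(-1)^{[a][b]}g_{ab}$), $g^{ab}=g_{ab}$, indices raised/lowered by $V_a=\sum_bg_{ab}V^b$, $V^c=\sum_ag^{ac}V_a$; $M=m-2n$; standing assumption $m>4$, $n>1$. $\mathfrak g=\mathfrak{osp}(m|2n)$ is identified with tensors $A^{ab}=-(-1)^{[a][b]}A^{ba}$ with bracket $[A,B]^{ab}=\sum_c\big(A^a{}_cB^{cb}-(-1)^{[a][b]}A^b{}_cB^{ca}\big)$ and invariant form $\langle U,V\rangle=\sum_{a,b}U_{ab}V^{ba}$ (proportional to the Killing form). $\mathfrak g\otimes\mathfrak g$ is identified with tensors $T^{abcd}$ super-antisymmetric in $(a,b)$ and in $(c,d)$; $\mathfrak g\odot\mathfrak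 g$ (resp. $\mathfrak g\wedge\mathfrak g$) are those with $T^{abcd}=\pm(-1)^{([a]+[b])([c]+[d])}T^{cdab}$ (sign $+$, resp. $-$). Define $q(V)^{abcd}=\frac13\big(V^{abcd}+(-1)^{[a]([b]+[c])}V^{bcad}-(-1)^{[b][c]}V^{acbd}\big)$ on $\mathfrak g\odot\mathfrak g$ and $\phi(X)^{abcd}=\frac14\big(g^{bc}X^{ad}-(-1)^{[a][b]}g^{ac}X^{bd}-(-1)^{[c][d]}g^{bd}X^{ac}+(-1)^{[a][b]+[c][d]}g^{ad}X^{bc}\big)$ for $X\in\mathbb C^{m|2n}\otimes\mathbb C^{m|2n}$. The first Cartan product is $\mathfrak g\circledcirc_1\mathfrak g=\{V\in\mathfrak g\odot\mathfrak g:\sum_{b,c}g_{bc}V^{acbd}=0,\ q(V)=0\}$; for $M\notin\{1,2\}$, $\mathfrak g\otimes\mathfrak g=(\mathfrak g\circledcirc_1\mathfrak g)\oplus\mathrm{Im}(q)\oplus\phi(\mathbb C^{m|2n}\odot\mathbb C^{m|2n})\oplus(\mathfrak g\wedge\mathfrak g)$ as $\mathfrak g$-modules, and $X\circledcirc_1Y$ denotes the component of $X\otimes Y$ in $\mathfrak g\circledcirc_1\mathfrak g$. *)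

theory Defs
  imports Complex_Main
begin

text \<open>Indices of C^{m|2n} are 0-based: {0..<m+2n}; index a is even iff a < m.\<close>

type_synonym t2 = "nat \<Rightarrow> nat \<Rightarrow> complex"
type_synonym t4 = "nat \<Rightarrow> nat \<Rightarrow> nat \<Rightarrow> nat \<Rightarrow> complex"
type_synonym tal = "nat list \<Rightarrow> complex"

definition idx :: "nat \<Rightarrow> nat \<Rightarrow> nat set" where
  "idx m n = {..<m + 2*n}"

definition par :: "nat \<Rightarrow> nat \<Rightarrow> nat" where
  "par m a = (if a < m then 0 else 1)"

definition sg :: "nat \<Rightarrow> complex" where
  "sg k = (-1) ^ k"

text \<open>Orthosymplectic metric with the convention g^{ab} = g_{ab} (so that raising and lowering are
mutually inverse: sum_a g^{ac} g_{ab} = delta_bc).\<close>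
definition osp_metric :: "nat \<Rightarrow> nat \<Rightarrow> t2 \<Rightarrow> bool" where
  "osp_metric m n G \<longleftrightarrow>
     (\<forall>a b. (a \<notin> idx m n \<or> b \<notin> idx m n) \<longrightarrow> G a b = 0) \<and>
     (\<forall>a b. par m a \<noteq> par m b \<longrightarrow> G a b = 0) \<and>
     (\<forall>a b. G b a = sg (par m a * par m b) * G a b) \<and>
     (\<forall>b\<in>idx m n. \<forall>c\<in>idx m n. (\<Sum>a\<in>idx m n. G a c * G a b) = (if b = c then 1 else 0))"

definition supp2 :: "nat \<Rightarrow> nat \<Rightarrow> t2 \<Rightarrow> bool" where
  "supp2 m n X \<longleftrightarrow> (\<forall>a b. (a \<notin> idx m n \<or> b \<notin> idx m n) \<longrightarrow> X a b = 0)"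

definition supp4 :: "nat \<Rightarrow> nat \<Rightarrow> t4 \<Rightarrow> bool" where
  "supp4 m n T \<longleftrightarrow> (\<forall>a b c d. (a \<notin> idx m n \<or> b \<notin> idx m n \<or> c \<notin> idx m n \<or> d \<notin> idx m n)
                         \<longrightarrow> T a b c d = 0)"

text \<open>osp(m|2n) as super-antisymmetric 2-tensors A^{ab}.\<close>
definition osp :: "nat \<Rightarrow> nat \<Rightarrow> t2 set" where
  "osp m n = {A. supp2 m n A \<and> (\<forall>a b. A a b = - sg (par m a * par m b) * A b a)}"

definition low2 :: "nat \<Rightarrow> nat \<Rightarrow> t2 \<Rightarrow> t2 \<Rightarrow> t2" where
  "low2 m n G A = (\<lambda>a c. \<Sum>d\<in>idx m n. G c d * A a d)"

definition lowall :: "nat \<Rightarrow> nat \<Rightarrow> t2 \<Rightarrow> t2 \<Rightarrow> t2" where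
  "lowall m n G A = (\<lambda>a b. \<Sum>c\<in>idx m n. \<Sum>d\<in>idx m n. G a c * G b d * A c d)"

definition bracket :: "nat \<Rightarrow> nat \<Rightarrow> t2 \<Rightarrow> t2 \<Rightarrow> t2 \<Rightarrow> t2" where
  "bracket m n G A B = (\<lambda>a b. \<Sum>c\<in>idx m n.
      low2 m n G A a c * B c b - sg (par m a * par m b) * low2 m n G A b c * B c a)"

definition form :: "nat \<Rightarrow> nat \<Rightarrow> t2 \<Rightarrow> t2 \<Rightarrow> t2 \<Rightarrow> complex" where
  "form m n G U V = (\<Sum>a\<in>idx m n. \<Sum>b\<in>idx m n. lowall m n G U a b * V b a)"

definition gg :: "nat \<Rightarrow> nat \<Rightarrow> t4 set" where
  "gg m n = {T. supp4 m n T \<and>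
     (\<forall>a b c d. T a b c d = - sg (par m a * par m b) * T b a c d) \<and>
     (\<forall>a b c d. T a b c d = - sg (par m c * par m d) * T a b d c)}"

definition gsym :: "nat \<Rightarrow> nat \<Rightarrow> t4 set" where
  "gsym m n = {T \<in> gg m n. \<forall>a b c d.
      T a b c d = sg ((par m a + par m b) * (par m c + par m d)) * T c d a b}"

definition gwedge :: "nat \<Rightarrow> nat \<Rightarrow> t4 set" where
  "gwedge m n = {T \<in> gg m n. \<forall>a b c d.
      T a b c d = - sg ((par m a + par m b) * (par m c + par m d)) * T c d a b}"

definition vsym :: "nat \<Rightarrow> nat \<Rightarrow> t2 set" where
  "vsym m n = {X. supp2 m n X \<and> (\<forall>a b. X a b = sg (par m a * par m b) * X b a)}"

definition qmap :: "nat \<Rightarrow> nat \<Rightarrow> t4 \<Rightarrow> t4" where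
  "qmap m n V = (\<lambda>a b c d. (V a b c d + sg (par m a * (par m b + par m c)) * V b c a d
                              - sg (par m b * par m c) * V a c b d) / 3)"

definition phi :: "nat \<Rightarrow> nat \<Rightarrow> t2 \<Rightarrow> t2 \<Rightarrow> t4" where
  "phi m n G X = (\<lambda>a b c d. (G b c * X a d
        - sg (par m a * par m b) * G a c * X b d
        - sg (par m c * par m d) * G b d * X a c
        + sg (par m a * par m b + par m c * par m d) * G a d * X b c) / 4)"

definition cartan1 :: "nat \<Rightarrow> nat \<Rightarrow> t2 \<Rightarrow> t4 set" where
  "cartan1 m n G = {V \<in> gsym m n.
      (\<forall>a d. (\<Sum>b\<in>idx m n. \<Sum>c\<in>idx m n. G b c * V a c b d) = 0) \<and>
      qmap m n V = (\<lambda>a b c d. 0)}"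

definition tens :: "t2 \<Rightarrow> t2 \<Rightarrow> t4" where
  "tens X Y = (\<lambda>a b c d. X a b * Y c d)"

text \<open>X \<circledcirc>_1 Y: the component of X \<otimes> Y in the first Cartan product w.r.t. the decomposition
 g\<otimes>g = cartan1 \<oplus> Im q \<oplus> phi(V\<odot>V) \<oplus> g\<wedge>g.\<close>
definition cprod1 :: "nat \<Rightarrow> nat \<Rightarrow> t2 \<Rightarrow> t2 \<Rightarrow> t2 \<Rightarrow> t4" where
  "cprod1 m n G X Y = (THE W. W \<in> cartan1 m n G \<and>
      (\<exists>V\<in>gsym m n. \<exists>S\<in>vsym m n. \<exists>Z\<in>gwedge m n.
         tens X Y = (\<lambda>a b c d. W a b c d + qmap m n V a b c d + phi m n G S a b c d + Z a b c d)))"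

text \<open>Tensor algebra of g, realised inside the tensor algebra of C^{m|2n}: an element is a
 function on index words (the word of length 2k carries the degree-k component); product is
 concatenation (no signs).\<close>
definition tmul :: "tal \<Rightarrow> tal \<Rightarrow> tal" where
  "tmul s t = (\<lambda>w. \<Sum>i\<le>length w. s (take i w) * t (drop i w))"

definition tone :: tal where
  "tone = (\<lambda>w. if w = [] then 1 else 0)"

definition emb2 :: "t2 \<Rightarrow> tal" where
  "emb2 A = (\<lambda>w. if length w = 2 then A (w!0) (w!1) else 0)"

definition emb4 :: "t4 \<Rightarrow> tal" where
  "emb4 T = (\<lambda>w. if length w = 4 then T (w!0) (w!1) (w!2) (w!3) else 0)"

definition relgen :: "nat \<Rightarrow> nat \<Rightarrow> t2 \<Rightarrow> complex \<Rightarrow> t2 \<Rightarrow> t2 \<Rightarrow> tal" where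
  "relgen m n G lam X Y = (\<lambda>w. emb4 (tens X Y) w - emb4 (cprod1 m n G X Y) w
      - emb2 (bracket m n G X Y) w / 2 - lam * form m n G X Y * tone w)"

definition mono :: "t2 list \<Rightarrow> tal" where
  "mono Xs = foldr (\<lambda>X acc. tmul (emb2 X) acc) Xs tone"

text \<open>The two-sided ideal J^1_\<lambda> of \<otimes>g generated by the relgen elements (the algebra \<otimes>g is
 spanned by monomials, so the ideal is the span of monomial * generator * monomial).\<close>
inductive_set Jideal :: "nat \<Rightarrow> nat \<Rightarrow> t2 \<Rightarrow> complex \<Rightarrow> tal set"
  for m n G lam where
  zero: "(\<lambda>w. 0) \<in> Jideal m n G lam"
| add: "x \<in> Jideal m n G lam \<Longrightarrow> y \<in> Jideal m n G lam \<Longrightarrow> (\<lambda>w. x w + y w) \<in> Jideal m n G lam"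
| smult: "x \<in> Jideal m n G lam \<Longrightarrow> (\<lambda>w. c * x w) \<in> Jideal m n G lam"
| gen: "set Xs \<subseteq> osp m n \<Longrightarrow> set Ys \<subseteq> osp m n \<Longrightarrow> X \<in> osp m n \<Longrightarrow> Y \<in> osp m n \<Longrightarrow>
        tmul (tmul (mono Xs) (relgen m n G lam X Y)) (mono Ys) \<in> Jideal m n G lam"

end

theory Submission
  imports Defs
begin

text \<open>
  Write \<open>E a b\<close> for the standard spanning elements of \<open>osp(m|2n)\<close> and \<open>M = m - 2n\<close>. Two families of
  relations hold modulo the ideal. For even \<open>c\<close>, the symmetric part of the cyclic sum
  \<open>E a b * E c d + s * E b c * E a d - E a c * E b d\<close> (with \<open>s = (-1)^([a][b])\<close>) is totally
  super-antisymmetric, so it has no Cartan component and the sum reduces to its bracket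
  \<open>g d c * E a b - g d b * E a c + s * g d a * E b c\<close>. Secondly
  \<open>(\<Sum>d f. g d f * E c d * E f e)\<close> lies in the image of \<open>phi\<close> and reduces to
  \<open>(M-2)/2 * E c e + 2 * \<lambda> * (M-1) * g e c\<close>.

  Multiplying the first relation by \<open>E f e\<close> from the right, contracting \<open>d\<close> with \<open>f\<close>, and reducing
  the cubic terms by the second relation and the quadratic ones by the first gives
  \<open>((M-4)/2 + 2 * \<lambda> * (M-1)) * (g e c * E a b - g e b * E a c + s * g e a * E b c) = 0\<close>.
  The scalar vanishes only for the excluded \<open>\<lambda>\<close>; contracting \<open>c\<close> with \<open>e\<close> then yields \<open>E a b\<close>.
\<close>

section \<open>Super-symmetry types of tensors\<close>

text \<open>The contraction that defines \<open>cartan1\<close>. Bracket and form turn out to factor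
  through it, so this one linear map controls every lower-order term.\<close>

definition trc :: "nat \<Rightarrow> nat \<Rightarrow> t2 \<Rightarrow> t4 \<Rightarrow> t2" where
  "trc m n G T = (\<lambda>a d. \<Sum>b\<in>idx m n. \<Sum>c\<in>idx m n. G b c * T a c b d)"

text \<open>The reversed index order in \<open>X\<close> makes this a supertrace: the metric itself
  gets the value m - 2n, not m + 2n.\<close>

definition str :: "nat \<Rightarrow> nat \<Rightarrow> t2 \<Rightarrow> t2 \<Rightarrow> complex" where
  "str m n G X = (\<Sum>a\<in>idx m n. \<Sum>b\<in>idx m n. G a b * X b a)"

text \<open>Total super-antisymmetry, given by the three adjacent transpositions. These tensors form
  the image of \<open>qmap\<close> on \<open>gsym\<close>, and \<open>qmap\<close> is a projection
  onto them.\<close>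

definition asym4 :: "nat \<Rightarrow> nat \<Rightarrow> t4 set" where
  "asym4 m n = {T. supp4 m n T \<and>
     (\<forall>a b c d. T a b c d = - sg (par m a * par m b) * T b a c d) \<and>
     (\<forall>a b c d. T a b c d = - sg (par m b * par m c) * T a c b d) \<and>
     (\<forall>a b c d. T a b c d = - sg (par m c * par m d) * T a b d c)}"

text \<open>A case split on the parities then turns every sign into 1 or -1; most sign identities
  below are settled this way.\<close>

lemma par_sg_simps [simp]: "a < m \<Longrightarrow> par m a = 0" "\<not> a < m \<Longrightarrow> par m a = 1"
  "sg 0 = 1" "sg (Suc 0) = -1" "sg 1 = -1" "sg 2 = 1" "sg 4 = 1" "sg (Suc (Suc k)) = sg k"
  by (simp_all add: par_def sg_def)

lemma sg_sq [simp]: "sg k * sg k = 1" "sg k * (sg k * x) = x"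
  by (simp_all add: sg_def flip: power_add mult.assoc)

lemma gg_swap:
  assumes "T \<in> gg m n"
  shows "T a b c d = - sg (par m a * par m b) * T b a c d"
    and "T a b c d = - sg (par m c * par m d) * T a b d c"
  using assms unfolding gg_def by blast+

lemma gsym_swap:
  assumes "T \<in> gsym m n"
  shows "T a b c d = - sg (par m a * par m b) * T b a c d"
    and "T a b c d = - sg (par m c * par m d) * T a b d c"
    and "T a b c d = sg ((par m a + par m b) * (par m c + par m d)) * T c d a b"
  using assms unfolding gsym_def gg_def by blast+

lemma asym4_swap:
  assumes "T \<in> asym4 m n"
  shows "T a b c d = - sg (par m a * par m b) * T b a c d"
    and "T a b c d = - sg (par m b * par m c) * T a c b d"
    and "T a b c d = - sg (par m c * par m d) * T a b d c"
  using assms unfolding asym4_def by blast+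

lemma vsym_swap: "X \<in> vsym m n \<Longrightarrow> X a b = sg (par m a * par m b) * X b a"
  unfolding vsym_def by blast

lemma osp_swap: "X \<in> osp m n \<Longrightarrow> X a b = - sg (par m a * par m b) * X b a"
  unfolding osp_def by blast

lemma gsym_gg: "T \<in> gsym m n \<Longrightarrow> T \<in> gg m n" by (simp add: gsym_def)

text \<open>\<open>qmap\<close> is a cyclic sum over the first three indices, so antisymmetry of
  \<open>V\<close> in its first pair spreads to all three; the symmetry under exchange of the pairs
  carries it on to the fourth.\<close>

lemma qmap_asym4:
  assumes "V \<in> gsym m n" shows "qmap m n V \<in> asym4 m n"
proof -
  have 1: "qmap m n V a b c d = - sg (par m a * par m b) * qmap m n V b a c d" for a b c d
    using gsym_swap(1)[OF assms, of a b c d]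
    by (cases "a < m"; cases "b < m"; cases "c < m"; simp add: qmap_def field_simps)
  have 2: "qmap m n V a b c d = - sg (par m b * par m c) * qmap m n V a c b d" for a b c d
    using gsym_swap(1)[OF assms, of b c a d]
    by (cases "a < m"; cases "b < m"; cases "c < m"; simp add: qmap_def field_simps)
  have 3: "qmap m n V a b c d = - sg (par m c * par m d) * qmap m n V a b d c" for a b c d
    using gsym_swap(2)[OF assms, of a b c d] gsym_swap(3)[OF assms, of b c a d]
      gsym_swap(3)[OF assms, of a c b d]
    by (cases "a < m"; cases "b < m"; cases "c < m"; cases "d < m"; simp add: qmap_def field_simps)
  have "supp4 m n V" using assms by (simp add: gsym_def gg_def)
  then have "supp4 m n (qmap m n V)"
    unfolding supp4_def qmap_def by auto
  with 1 2 3 show ?thesis unfolding asym4_def by blast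
qed

text \<open>Exchanging the pairs is a product of four adjacent transpositions, so the four minus
  signs cancel.\<close>

lemma asym4_gsym:
  assumes "T \<in> asym4 m n" shows "T \<in> gsym m n"
proof -
  have "T a b c d = sg ((par m a + par m b) * (par m c + par m d)) * T c d a b" for a b c d
    using asym4_swap(2)[OF assms, of a b c d] asym4_swap(1)[OF assms, of a c b d]
      asym4_swap(3)[OF assms, of c a b d] asym4_swap(2)[OF assms, of c a d b]
    by (cases "a < m"; cases "b < m"; cases "c < m"; cases "d < m"; simp)
  with assms show ?thesis unfolding asym4_def gsym_def gg_def by blast
qed

text \<open>Each of the three terms equals \<open>T\<close> itself, which is what the factor 1/3
  normalises.\<close>

lemma qmap_asym4_id:
  assumes "T \<in> asym4 m n" shows "qmap m n T = T"
proof (intro ext)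
  fix a b c d
  show "qmap m n T a b c d = T a b c d"
    using asym4_swap(2)[OF assms, of a b c d] asym4_swap(1)[OF assms, of a c b d]
      asym4_swap(2)[OF assms, of c a b d] asym4_swap(1)[OF assms, of a b c d]
      asym4_swap(2)[OF assms, of b a c d]
    by (cases "a < m"; cases "b < m"; cases "c < m"; simp add: qmap_def)
qed

section \<open>Closure of the tensor spaces under linear combinations\<close>

lemma gg_supp: "T \<in> gg m n \<Longrightarrow> supp4 m n T" by (simp add: gg_def)
lemma osp_supp: "X \<in> osp m n \<Longrightarrow> supp2 m n X" by (simp add: osp_def)
lemma vsym_supp: "X \<in> vsym m n \<Longrightarrow> supp2 m n X" by (simp add: vsym_def)

lemma gwedge_swap:
  "T \<in> gwedge m n \<Longrightarrow> T a b c d = - sg ((par m a + par m b) * (par m c + par m d)) * T c d a b"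
  unfolding gwedge_def by blast

text \<open>Every symmetry condition has the shape x = s * y. The combination T + k * U covers sums,
  differences and, with T = 0, multiples.\<close>

lemma scaled_lin: "x = s * y \<Longrightarrow> x' = s * y' \<Longrightarrow> x + k * x' = s * (y + k * y')" for x :: complex
  by (simp add: algebra_simps)

lemma gg_lin:
  assumes "T \<in> gg m n" "U \<in> gg m n" shows "(\<lambda>a b c d. T a b c d + k * U a b c d) \<in> gg m n"
proof -
  have "T a b c d + k * U a b c d = - sg (par m a * par m b) * (T b a c d + k * U b a c d)"
    "T a b c d + k * U a b c d = - sg (par m c * par m d) * (T a b d c + k * U a b d c)" for a b c d
    by (rule scaled_lin[OF gg_swap(1)[OF assms(1)] gg_swap(1)[OF assms(2)]],
        rule scaled_lin[OF gg_swap(2)[OF assms(1)] gg_swap(2)[OF assms(2)]])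
  moreover have "supp4 m n (\<lambda>a b c d. T a b c d + k * U a b c d)"
    using gg_supp[OF assms(1)] gg_supp[OF assms(2)] unfolding supp4_def by auto
  ultimately show ?thesis unfolding gg_def by blast
qed

lemma gsym_lin:
  assumes "T \<in> gsym m n" "U \<in> gsym m n" shows "(\<lambda>a b c d. T a b c d + k * U a b c d) \<in> gsym m n"
proof -
  have "T a b c d + k * U a b c d = sg ((par m a + par m b) * (par m c + par m d)) * (T c d a b + k * U c d a b)" for a b c d
    by (rule scaled_lin[OF gsym_swap(3)[OF assms(1)] gsym_swap(3)[OF assms(2)]])
  then show ?thesis using gg_lin[of T m n U k] assms unfolding gsym_def by blast
qed

lemma gwedge_lin:
  assumes "T \<in> gwedge m n" "U \<in> gwedge m n" shows "(\<lambda>a b c d. T a b c d + k * U a b c d) \<in> gwedge m n"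
proof -
  have "T a b c d + k * U a b c d = - sg ((par m a + par m b) * (par m c + par m d)) * (T c d a b + k * U c d a b)" for a b c d
    by (rule scaled_lin[OF gwedge_swap[OF assms(1)] gwedge_swap[OF assms(2)]])
  then show ?thesis using gg_lin[of T m n U k] assms unfolding gwedge_def by blast
qed

lemma vsym_lin:
  assumes "X \<in> vsym m n" "Y \<in> vsym m n" shows "(\<lambda>a b. X a b + k * Y a b) \<in> vsym m n"
proof -
  have "X a b + k * Y a b = sg (par m a * par m b) * (X b a + k * Y b a)" for a b
    by (rule scaled_lin[OF vsym_swap[OF assms(1)] vsym_swap[OF assms(2)]])
  moreover have "supp2 m n (\<lambda>a b. X a b + k * Y a b)"
    using vsym_supp[OF assms(1)] vsym_supp[OF assms(2)] unfolding supp2_def by auto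
  ultimately show ?thesis unfolding vsym_def by blast
qed

lemma zero_mem: "(\<lambda>a b c d. 0) \<in> gg m n" "(\<lambda>a b c d. 0) \<in> gsym m n" "(\<lambda>a b c d. 0) \<in> gwedge m n"
  "(\<lambda>a b. 0) \<in> vsym m n"
  by (simp_all add: gg_def gsym_def gwedge_def vsym_def supp2_def supp4_def)

lemma qmap_lin: "qmap m n (\<lambda>a b c d. T a b c d + k * U a b c d) a b c d
    = qmap m n T a b c d + k * qmap m n U a b c d"
  by (simp add: qmap_def field_simps)

lemma phi_lin: "phi m n G (\<lambda>a b. X a b + k * Y a b) a b c d
    = phi m n G X a b c d + k * phi m n G Y a b c d"
  by (simp add: phi_def field_simps)

lemma trc_lin: "trc m n G (\<lambda>a b c d. T a b c d + k * U a b c d) a d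
    = trc m n G T a d + k * trc m n G U a d"
  by (simp add: trc_def distrib_left sum.distrib sum_distrib_left mult.left_commute)

lemma str_lin: "str m n G (\<lambda>a b. X a b + k * Y a b) = str m n G X + k * str m n G Y"
  by (simp add: str_def distrib_left sum.distrib sum_distrib_left mult.left_commute)

lemma cartan1_iff: "W \<in> cartan1 m n G \<longleftrightarrow>
  W \<in> gsym m n \<and> (\<forall>a d. trc m n G W a d = 0) \<and> qmap m n W = (\<lambda>a b c d. 0)"
  by (simp add: cartan1_def trc_def)

lemma cartan1_lin: "T \<in> cartan1 m n G \<Longrightarrow> U \<in> cartan1 m n G \<Longrightarrow>
   (\<lambda>a b c d. T a b c d + k * U a b c d) \<in> cartan1 m n G"
  by (simp add: cartan1_iff gsym_lin trc_lin qmap_lin fun_eq_iff)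

lemma gsym_gwedge_zero:
  assumes "T \<in> gsym m n" "T \<in> gwedge m n" shows "T a b c d = 0"
proof -
  have "T a b c d = - T a b c d"
    using gsym_swap(3)[OF assms(1), of a b c d] gwedge_swap[OF assms(2), of a b c d] by simp
  then show ?thesis by simp
qed

text \<open>A signed involution that preserves \<open>gg\<close>, with eigenspace
  \<open>gsym\<close> for 1 and \<open>gwedge\<close> for -1.\<close>

definition pair_swap :: "nat \<Rightarrow> t4 \<Rightarrow> t4" where
  "pair_swap m T = (\<lambda>a b c d. sg ((par m a + par m b) * (par m c + par m d)) * T c d a b)"

lemma pair_swap_gg:
  assumes "T \<in> gg m n" shows "pair_swap m T \<in> gg m n"
proof -
  have "pair_swap m T a b c d = - sg (par m a * par m b) * pair_swap m T b a c d" for a b c d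
    using gg_swap(2)[OF assms, of c d a b] by (simp add: pair_swap_def add.commute)
  moreover have "pair_swap m T a b c d = - sg (par m c * par m d) * pair_swap m T a b d c" for a b c d
    using gg_swap(1)[OF assms, of c d a b] by (simp add: pair_swap_def add.commute)
  moreover have "supp4 m n (pair_swap m T)"
    using gg_supp[OF assms] by (auto simp: supp4_def pair_swap_def)
  ultimately show ?thesis unfolding gg_def by blast
qed

lemma gsym_part:
  assumes "T \<in> gg m n"
  shows "(\<lambda>a b c d. (T a b c d + pair_swap m T a b c d) / 2) \<in> gsym m n" (is "?S \<in> _")
    and "(\<lambda>a b c d. (T a b c d - pair_swap m T a b c d) / 2) \<in> gwedge m n" (is "?W \<in> _")
proof -
  have s: "(\<lambda>a b c d. T a b c d + 1 * pair_swap m T a b c d) \<in> gg m n"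
    "(\<lambda>a b c d. T a b c d + (-1) * pair_swap m T a b c d) \<in> gg m n"
    using gg_lin[OF assms pair_swap_gg[OF assms]] by blast+
  have "?S \<in> gg m n" "?W \<in> gg m n"
    using gg_lin[OF zero_mem(1) s(1), of "1/2"] gg_lin[OF zero_mem(1) s(2), of "1/2"] by simp_all
  moreover have "?S a b c d = sg ((par m a + par m b) * (par m c + par m d)) * ?S c d a b"
    "?W a b c d = - sg ((par m a + par m b) * (par m c + par m d)) * ?W c d a b" for a b c d
  proof -
    define s where "s = sg ((par m a + par m b) * (par m c + par m d))"
    have "pair_swap m T a b c d = s * T c d a b" "pair_swap m T c d a b = s * T a b c d" "s * s = 1"
      by (simp_all add: pair_swap_def s_def mult.commute)
    then show "?S a b c d = sg ((par m a + par m b) * (par m c + par m d)) * ?S c d a b"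
      "?W a b c d = - sg ((par m a + par m b) * (par m c + par m d)) * ?W c d a b"
      unfolding s_def[symmetric] by algebra+
  qed
  ultimately show "?S \<in> gsym m n" "?W \<in> gwedge m n"
    unfolding gsym_def gwedge_def by blast+
qed

text \<open>A super-symmetric metric is contracted with an antisymmetric pair of indices, so
  renaming the summation indices changes the sign.\<close>

lemma trc_asym4:
  assumes T: "T \<in> asym4 m n" and G: "osp_metric m n G" shows "trc m n G T a d = 0"
proof -
  have g: "G b c = sg (par m b * par m c) * G c b" for b c
    using G unfolding osp_metric_def by (metis mult.commute)
  have "trc m n G T a d = (\<Sum>b\<in>idx m n. \<Sum>c\<in>idx m n. - (G c b * T a b c d))"
    unfolding trc_def
  proof (intro sum.cong refl)
    fix b c
    show "G b c * T a c b d = - (G c b * T a b c d)"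
      using g[of b c] asym4_swap(2)[OF T, of a c b d] by (simp add: mult.commute[of "par m b"])
  qed
  also have "\<dots> = - trc m n G T a d"
    unfolding trc_def sum_negf by (subst sum.swap) rule
  finally show ?thesis by simp
qed

section \<open>Splitting off the first Cartan product\<close>

locale osp_space =
  fixes m n :: nat and G :: t2
  assumes metric: "osp_metric m n G"
begin

abbreviation "I \<equiv> idx m n"
abbreviation "p \<equiv> par m"

lemma fin [simp]: "finite I" by (simp add: idx_def)

lemma G_supp: "a \<notin> I \<Longrightarrow> G a b = 0" "b \<notin> I \<Longrightarrow> G a b = 0"
  using metric unfolding osp_metric_def by blast+

lemma G_par: "p a \<noteq> p b \<Longrightarrow> G a b = 0"
  using metric unfolding osp_metric_def by blast

lemma G_sym: "G b a = sg (p a * p b) * G a b"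
  using metric unfolding osp_metric_def by blast

lemma G_orth: "b \<in> I \<Longrightarrow> c \<in> I \<Longrightarrow> (\<Sum>a\<in>I. G a c * G a b) = (if b = c then 1 else 0)"
  using metric unfolding osp_metric_def by blast

lemma G_vsym: "G \<in> vsym m n"
proof -
  have "G a b = sg (p a * p b) * G b a" for a b using G_sym[of a b] by (simp add: mult.commute)
  then show ?thesis unfolding vsym_def supp2_def using G_supp by blast
qed

lemma G_orth_left: "c \<in> I \<Longrightarrow> (\<And>b. b \<notin> I \<Longrightarrow> X b = 0) \<Longrightarrow> (\<Sum>a\<in>I. G a c * (\<Sum>b\<in>I. G a b * X b)) = X c"
proof -
  assume c: "c \<in> I"
  have "(\<Sum>a\<in>I. G a c * (\<Sum>b\<in>I. G a b * X b)) = (\<Sum>a\<in>I. \<Sum>b\<in>I. G a c * G a b * X b)"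
    by (simp add: sum_distrib_left mult.assoc)
  also have "\<dots> = (\<Sum>b\<in>I. (\<Sum>a\<in>I. G a c * G a b) * X b)"
    by (subst sum.swap) (simp add: sum_distrib_right)
  also have "\<dots> = (\<Sum>b\<in>I. (if b = c then X b else 0))"
    by (intro sum.cong) (auto simp: G_orth c)
  also have "\<dots> = X c" using c by simp
  finally show ?thesis .
qed

abbreviation "M \<equiv> (of_nat m - 2 * of_nat n :: complex)"

text \<open>The metric pairs only indices of equal parity, so by orthogonality each column
  contributes the sign of its parity.\<close>

lemma str_G: "str m n G G = M"
proof -
  have "str m n G G = (\<Sum>b\<in>I. \<Sum>a\<in>I. G a b * G b a)"
    unfolding str_def by (rule sum.swap)
  also have "\<dots> = (\<Sum>b\<in>I. sg (p b))"
  proof (intro sum.cong refl)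
    fix b assume b: "b \<in> I"
    have "G a b * G b a = sg (p b) * (G a b * G a b)" for a
      using G_sym[of b a] G_par[of a b] by (cases "a < m"; cases "b < m"; simp)
    then show "(\<Sum>a\<in>I. G a b * G b a) = sg (p b)"
      using G_orth[OF b b] by (simp only: flip: sum_distrib_left) simp
  qed
  also have "\<dots> = (\<Sum>b<m. sg (p b)) + (\<Sum>b=m..<m+2*n. sg (p b))"
    unfolding idx_def using sum.atLeastLessThan_concat[of 0 m "m+2*n" "\<lambda>b. sg (p b)"]
    by (simp add: atLeast0LessThan)
  also have "\<dots> = M" by simp
  finally show ?thesis .
qed

lemma phi_gg:
  assumes "supp2 m n X" shows "phi m n G X \<in> gg m n"
proof -
  have "phi m n G X a b c d = - sg (p a * p b) * phi m n G X b a c d" for a b c d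
    by (cases "a < m"; cases "b < m"; cases "c < m"; cases "d < m"; simp add: phi_def field_simps)
  moreover have "phi m n G X a b c d = - sg (p c * p d) * phi m n G X a b d c" for a b c d
    by (cases "a < m"; cases "b < m"; cases "c < m"; cases "d < m"; simp add: phi_def field_simps)
  moreover have "supp4 m n (phi m n G X)"
    using assms G_supp unfolding supp4_def supp2_def phi_def by auto
  ultimately show ?thesis unfolding gg_def by blast
qed

lemma phi_gsym:
  assumes X: "X \<in> vsym m n" shows "phi m n G X \<in> gsym m n"
proof -
  have "phi m n G X a b c d = sg ((p a + p b) * (p c + p d)) * phi m n G X c d a b" for a b c d
    using vsym_swap[OF X, of a c] vsym_swap[OF X, of a d] vsym_swap[OF X, of b c] vsym_swap[OF X, of b d]
      G_sym[of a c] G_sym[of a d] G_sym[of b c] G_sym[of b d] G_par[of a c] G_par[of b c] G_par[of a d] G_par[of b d]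
    by (cases "a < m"; cases "b < m"; cases "c < m"; cases "d < m"; simp add: phi_def field_simps)
  then show ?thesis using phi_gg[OF vsym_supp[OF X]] unfolding gsym_def by blast
qed

text \<open>Exchanging the pairs in \<open>phi\<close> amounts to transposing \<open>X\<close>.
  Hence an antisymmetric \<open>X\<close> contributes only to the wedge part, which keeps the
  contracted products below free of a Cartan component.\<close>

lemma phi_gwedge:
  assumes X: "X \<in> osp m n" shows "phi m n G X \<in> gwedge m n"
proof -
  have "phi m n G X a b c d = - sg ((p a + p b) * (p c + p d)) * phi m n G X c d a b" for a b c d
    using osp_swap[OF X, of a c] osp_swap[OF X, of a d] osp_swap[OF X, of b c] osp_swap[OF X, of b d]
      G_sym[of a c] G_sym[of a d] G_sym[of b c] G_sym[of b d] G_par[of a c] G_par[of b c] G_par[of a d] G_par[of b d]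
    by (cases "a < m"; cases "b < m"; cases "c < m"; cases "d < m"; simp add: phi_def field_simps)
  then show ?thesis using phi_gg[OF osp_supp[OF X]] unfolding gwedge_def by blast
qed

text \<open>In the cyclic sum each product such as G b c * X a d occurs twice, with opposite signs
  once the symmetries of \<open>G\<close> and \<open>X\<close> are used.\<close>

lemma qmap_phi:
  assumes X: "X \<in> vsym m n" shows "qmap m n (phi m n G X) = (\<lambda>a b c d. 0)"
proof (intro ext)
  fix a b c d
  show "qmap m n (phi m n G X) a b c d = 0"
    using vsym_swap[OF X, of a b] vsym_swap[OF X, of a c] vsym_swap[OF X, of b c]
      G_sym[of a b] G_sym[of a c] G_sym[of b c] G_par[of a c] G_par[of b c] G_par[of a b] G_par[of a d] G_par[of b d] G_par[of c d]
    by (cases "a < m"; cases "b < m"; cases "c < m"; cases "d < m"; simp add: phi_def qmap_def field_simps)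
qed

text \<open>Up to the factor 1/4 the four terms of \<open>phi\<close> contribute M * X, -X, -X and
  str X * G: the first closes a loop of two metrics, the next two use orthogonality.\<close>

lemma trc_phi:
  assumes X: "supp2 m n X"
  shows "trc m n G (phi m n G X) a d = ((M - 2) * X a d + str m n G X * G a d) / 4"
proof (cases "a \<in> I \<and> d \<in> I")
  case False
  then show ?thesis using X G_supp unfolding trc_def supp2_def phi_def by auto
next
  case True
  then have a: "a \<in> I" and d: "d \<in> I" by auto
  have t: "4 * (G b c * phi m n G X a c b d) = G b c * G c b * X a d
      - G b a * (G b c * X c d) - G c d * (G c b * X a b) + G a d * (G b c * X c b)" for b c
    using G_sym[of a b] G_sym[of b c] G_par[of a b] G_par[of b c] G_par[of c d] G_par[of a d]
    by (cases "a < m"; cases "b < m"; cases "c < m"; cases "d < m"; simp add: phi_def field_simps)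
  have "4 * trc m n G (phi m n G X) a d =
     (\<Sum>b\<in>I. \<Sum>c\<in>I. G b c * G c b * X a d
      - G b a * (G b c * X c d) - G c d * (G c b * X a b) + G a d * (G b c * X c b))"
    by (simp add: trc_def sum_distrib_left t)
  also have "\<dots> = str m n G G * X a d - (\<Sum>b\<in>I. G b a * (\<Sum>c\<in>I. G b c * X c d))
      - (\<Sum>b\<in>I. \<Sum>c\<in>I. G c d * (G c b * X a b)) + G a d * str m n G X"
    by (simp add: sum.distrib sum_subtractf str_def sum_distrib_left sum_distrib_right)
  also have "(\<Sum>b\<in>I. G b a * (\<Sum>c\<in>I. G b c * X c d)) = X a d"
    by (rule G_orth_left[OF a]) (use X in \<open>auto simp: supp2_def\<close>)
  also have "(\<Sum>b\<in>I. \<Sum>c\<in>I. G c d * (G c b * X a b)) = (\<Sum>c\<in>I. G c d * (\<Sum>b\<in>I. G c b * X a b))"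
    by (subst sum.swap) (simp add: sum_distrib_left)
  also have "\<dots> = X a d"
    by (rule G_orth_left[OF d]) (use X in \<open>auto simp: supp2_def\<close>)
  finally show ?thesis by (simp add: str_G field_simps)
qed

text \<open>Reversing the order of all four indices preserves \<open>T\<close> up to sign; it
  exchanges the free indices with each other and likewise the contracted ones.\<close>

lemma trc_vsym:
  assumes T: "T \<in> gsym m n" shows "trc m n G T \<in> vsym m n"
proof -
  have "trc m n G T a d = sg (p a * p d) * trc m n G T d a" for a d
  proof -
    have "G b c * T a c b d = sg (p a * p d) * (G c b * T d b c a)" for b c
      using G_sym[of b c] G_par[of b c] gsym_swap(3)[OF T, of a c b d] gsym_swap(1)[OF T, of b d a c]
        gsym_swap(2)[OF T, of d b a c]
      by (cases "a < m"; cases "b < m"; cases "c < m"; cases "d < m"; simp)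
    then have "trc m n G T a d = (\<Sum>b\<in>I. \<Sum>c\<in>I. sg (p a * p d) * (G c b * T d b c a))"
      by (simp add: trc_def)
    also have "\<dots> = sg (p a * p d) * trc m n G T d a"
      unfolding trc_def sum_distrib_left by (rule sum.swap)
    finally show ?thesis .
  qed
  moreover have "supp2 m n (trc m n G T)"
    using gg_supp[OF gsym_gg[OF T]] unfolding supp4_def supp2_def trc_def by auto
  ultimately show ?thesis unfolding vsym_def by blast
qed

text \<open>The relation behind the definite description in \<open>cprod1\<close>. It is linear in
  \<open>T\<close> and \<open>W\<close> jointly, even before existence and uniqueness are
  known.\<close>

definition splits :: "t4 \<Rightarrow> t4 \<Rightarrow> bool" where
  "splits T W \<longleftrightarrow> W \<in> cartan1 m n G \<and>
      (\<exists>V\<in>gsym m n. \<exists>S\<in>vsym m n. \<exists>Z\<in>gwedge m n.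
         T = (\<lambda>a b c d. W a b c d + qmap m n V a b c d + phi m n G S a b c d + Z a b c d))"

lemma splits_lin:
  assumes "splits T W" "splits T' W'"
  shows "splits (\<lambda>a b c d. T a b c d + k * T' a b c d) (\<lambda>a b c d. W a b c d + k * W' a b c d)"
proof -
  obtain V S Z where V: "V \<in> gsym m n" and S: "S \<in> vsym m n" and Z: "Z \<in> gwedge m n"
     and W: "W \<in> cartan1 m n G"
     and T: "T = (\<lambda>a b c d. W a b c d + qmap m n V a b c d + phi m n G S a b c d + Z a b c d)"
    using assms(1) unfolding splits_def by auto
  obtain V' S' Z' where V': "V' \<in> gsym m n" and S': "S' \<in> vsym m n" and Z': "Z' \<in> gwedge m n"
     and W': "W' \<in> cartan1 m n G"
     and T': "T' = (\<lambda>a b c d. W' a b c d + qmap m n V' a b c d + phi m n G S' a b c d + Z' a b c d)"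
    using assms(2) unfolding splits_def by auto
  show ?thesis unfolding splits_def
    by (intro conjI cartan1_lin W W' bexI[OF _ gsym_lin[OF V V', of k]]
       bexI[OF _ vsym_lin[OF S S', of k]] bexI[OF _ gwedge_lin[OF Z Z', of k]])
      (simp add: T T' qmap_lin phi_lin fun_eq_iff algebra_simps)
qed

text \<open>Exchange of the pairs, \<open>qmap\<close> and \<open>trc\<close> isolate the wedge
  part, the image of \<open>qmap\<close> and the trace part in turn, so all of them vanish and
  \<open>W\<close> with them.\<close>

lemma splits_zero_unique:
  assumes d: "splits (\<lambda>a b c d. 0) W" and M: "M \<noteq> 1" "M \<noteq> 2"
  shows "W = (\<lambda>a b c d. 0)"
proof -
  obtain V S Z where V: "V \<in> gsym m n" and S: "S \<in> vsym m n" and Z: "Z \<in> gwedge m n"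
     and W: "W \<in> cartan1 m n G"
     and e: "\<And>a b c d. 0 = W a b c d + qmap m n V a b c d + phi m n G S a b c d + Z a b c d"
    using d unfolding splits_def by (auto simp: fun_eq_iff)
  have Q: "qmap m n V \<in> asym4 m n" by (rule qmap_asym4[OF V])
  define Y where "Y = (\<lambda>a b c d. (W a b c d + 1 * qmap m n V a b c d) + 1 * phi m n G S a b c d)"
  have Ys: "Y \<in> gsym m n" unfolding Y_def
    using W by (intro gsym_lin phi_gsym S asym4_gsym[OF Q]) (simp add: cartan1_iff)
  \<comment> \<open>\<open>Y\<close> is symmetric by construction and equals minus \<open>Z\<close>,
    so it lies in both eigenspaces of the exchange of pairs.\<close>
  have "Y = (\<lambda>a b c d. 0 + (-1) * Z a b c d)"
    using e by (simp add: Y_def fun_eq_iff eq_neg_iff_add_eq_0)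
  then have "Y \<in> gwedge m n" using gwedge_lin[OF zero_mem(3) Z, of "-1"] by simp
  then have Y0: "Y = (\<lambda>a b c d. 0)" using gsym_gwedge_zero[OF Ys] by blast
  have "qmap m n Y a b c d = qmap m n V a b c d" for a b c d
    unfolding Y_def qmap_lin using W S Q by (simp add: qmap_phi cartan1_iff qmap_asym4_id)
  then have q0: "qmap m n V a b c d = 0" for a b c d using Y0 by (simp add: qmap_def)
  have "trc m n G Y a d = trc m n G (phi m n G S) a d" for a d
    unfolding Y_def trc_lin using W Q by (simp add: cartan1_iff trc_asym4[OF Q metric])
  then have t: "trc m n G (phi m n G S) a d = 0" for a d using Y0 by (simp add: trc_def)
  have S2: "supp2 m n S" by (rule vsym_supp[OF S])
  have r: "(M - 2) * S a d + str m n G S * G a d = 0" for a d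
    using t[of a d] trc_phi[OF S2, of a d] by simp
  have "0 = str m n G (\<lambda>a d. (0 + (M - 2) * S a d) + str m n G S * G a d)"
    using r by (simp add: str_def)
  \<comment> \<open>The supertrace of the equation \<open>r\<close> gives 2 * (M - 1) * str S = 0,
    after which (M - 2) * S = 0 remains. Both excluded values of \<open>M\<close> enter
    here.\<close>
  also have "\<dots> = (M - 2) * str m n G S + str m n G S * M"
    unfolding str_lin str_G by (simp add: str_def)
  finally have "2 * (M - 1) * str m n G S = 0" by (simp add: algebra_simps)
  then have "str m n G S = 0" using M(1)
    by (metis mult_eq_0_iff right_minus_eq zero_neq_numeral)
  then have "S a d = 0" for a d using r[of a d] M by simp
  then have "phi m n G S a b c d = 0" for a b c d by (simp add: phi_def)
  then show ?thesis using fun_cong[OF Y0] q0 by (simp add: Y_def fun_eq_iff)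
qed

lemma splits_unique:
  assumes "splits T W" "splits T W'" "M \<noteq> 1" "M \<noteq> 2"
  shows "W = W'"
proof -
  have "(\<lambda>a b c d. W a b c d + (-1) * W' a b c d) = (\<lambda>a b c d. 0)"
    using splits_lin[OF assms(1,2), of "-1"] assms(3,4) by (intro splits_zero_unique) auto
  then show ?thesis by (simp add: fun_eq_iff)
qed

lemma splits_exists:
  assumes T: "T \<in> gg m n" and M: "M \<noteq> 1" "M \<noteq> 2"
  shows "\<exists>W. splits T W"
proof -
  define Y where "Y = (\<lambda>a b c d. (T a b c d + pair_swap m T a b c d) / 2)"
  define Z where "Z = (\<lambda>a b c d. (T a b c d - pair_swap m T a b c d) / 2)"
  have Y: "Y \<in> gsym m n" and Z: "Z \<in> gwedge m n"
    unfolding Y_def Z_def by (rule gsym_part[OF T])+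
  have Q: "qmap m n Y \<in> asym4 m n" by (rule qmap_asym4[OF Y])
  define R where "R = trc m n G Y"
  have R: "R \<in> vsym m n" unfolding R_def by (rule trc_vsym[OF Y])
  \<comment> \<open>The solution of (M - 2) * S + str S * G = 4 * R: its supertrace determines str S
    = 2 * str R / (M - 1), and then \<open>S\<close> follows.\<close>
  define S where "S = (\<lambda>a b. (0 + 4 / (M - 2) * R a b) + (- 2 * str m n G R / ((M - 2) * (M - 1))) * G a b)"
  have S: "S \<in> vsym m n" unfolding S_def by (intro vsym_lin zero_mem R G_vsym)
  have S2: "supp2 m n S" by (rule vsym_supp[OF S])
  have "str m n G S = 4 / (M - 2) * str m n G R + (- 2 * str m n G R / ((M - 2) * (M - 1))) * M"
    unfolding S_def str_lin str_G by (simp add: str_def)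
  also have "\<dots> = 2 * str m n G R / (M - 1)"
    using M by (simp add: divide_simps) (simp add: algebra_simps)
  finally have strS: "str m n G S = 2 * str m n G R / (M - 1)" .
  have tr: "trc m n G (phi m n G S) a d = R a d" for a d
    unfolding trc_phi[OF S2] strS unfolding S_def using M by (simp add: divide_simps)
  define W where "W = (\<lambda>a b c d. (Y a b c d + (-1) * qmap m n Y a b c d) + (-1) * phi m n G S a b c d)"
  have "W \<in> gsym m n" unfolding W_def by (intro gsym_lin Y phi_gsym S asym4_gsym Q)
  moreover have "trc m n G W a d = 0" for a d
    unfolding W_def trc_lin tr trc_asym4[OF Q metric] by (simp add: R_def)
  moreover have "qmap m n W = (\<lambda>a b c d. 0)"
    unfolding W_def qmap_lin fun_eq_iff qmap_asym4_id[OF Q] by (simp add: qmap_phi[OF S])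
  ultimately have "W \<in> cartan1 m n G" by (simp add: cartan1_iff)
  moreover have "T = (\<lambda>a b c d. W a b c d + qmap m n Y a b c d + phi m n G S a b c d + Z a b c d)"
    by (simp add: W_def Y_def Z_def fun_eq_iff field_simps)
  ultimately show ?thesis unfolding splits_def using Y S Z by blast
qed

lemma tens_gg:
  assumes "X \<in> osp m n" "Y \<in> osp m n" shows "tens X Y \<in> gg m n"
proof -
  have "tens X Y a b c d = - sg (p a * p b) * tens X Y b a c d" for a b c d
    using osp_swap[OF assms(1), of a b] by (simp add: tens_def)
  moreover have "tens X Y a b c d = - sg (p c * p d) * tens X Y a b d c" for a b c d
    using osp_swap[OF assms(2), of c d] by (simp add: tens_def)
  moreover have "supp4 m n (tens X Y)" using osp_supp[OF assms(1)] osp_supp[OF assms(2)] by (auto simp: supp4_def supp2_def tens_def)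
  ultimately show ?thesis unfolding gg_def by blast
qed

lemma splits_cprod1:
  assumes "X \<in> osp m n" "Y \<in> osp m n" and M: "M \<noteq> 1" "M \<noteq> 2"
  shows "splits (tens X Y) (cprod1 m n G X Y)"
proof -
  have "\<exists>!W. splits (tens X Y) W"
    using splits_exists[OF tens_gg[OF assms(1,2)] M] splits_unique M by blast
  then have "splits (tens X Y) (THE W. splits (tens X Y) W)" by (rule theI')
  then show ?thesis unfolding cprod1_def splits_def .
qed

end

section \<open>Relations modulo the ideal\<close>

text \<open>Together with \<open>form_trc\<close>: both lower-order terms depend on \<open>X\<close>
  and \<open>Y\<close> only through \<open>tens X Y\<close>, hence extend linearly to all of
  \<open>gg\<close>.\<close>

lemma bracket_trc: "bracket m n G X Y = (\<lambda>a b. trc m n G (tens X Y) a b - sg (par m a * par m b) * trc m n G (tens X Y) b a)"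
  by (simp add: bracket_def trc_def tens_def low2_def sum_subtractf sum_distrib_left sum_distrib_right mult_ac fun_eq_iff)

lemma form_trc: "form m n G X Y = str m n G (trc m n G (tens X Y))"
proof -
  have "form m n G X Y = (\<Sum>a\<in>idx m n. \<Sum>b\<in>idx m n. \<Sum>c\<in>idx m n. \<Sum>d\<in>idx m n. G a c * (G b d * (X c d * Y b a)))"
    by (simp add: form_def lowall_def sum_distrib_left sum_distrib_right mult_ac)
  also have "\<dots> = (\<Sum>a\<in>idx m n. \<Sum>c\<in>idx m n. \<Sum>b\<in>idx m n. \<Sum>d\<in>idx m n. G a c * (G b d * (X c d * Y b a)))"
    by (intro sum.cong refl sum.swap)
  also have "\<dots> = str m n G (trc m n G (tens X Y))"
    by (simp add: str_def trc_def tens_def sum_distrib_left)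
  finally show ?thesis .
qed

definition delta :: "nat \<Rightarrow> nat \<Rightarrow> complex" where "delta a x = (if a = x then 1 else 0)"

lemma delta_commute: "delta a x = delta x a" by (simp add: delta_def)

lemma sum_delta2:
  assumes "finite S" "x \<notin> S \<or> y \<notin> S \<Longrightarrow> f x y = 0"
  shows "(\<Sum>a\<in>S. \<Sum>b\<in>S. f a b * (delta a x * delta b y)) = f x y"
proof -
  have "(\<Sum>b\<in>S. f a b * (delta a x * delta b y)) = (if a = x then f x y else 0)" if "a \<in> S" for a
  proof -
    have "(\<Sum>b\<in>S. f a b * (delta a x * delta b y)) = (\<Sum>b\<in>S. if b = y then f a y * delta a x else 0)"
      by (intro sum.cong) (auto simp: delta_def)
    then show ?thesis using assms by (auto simp: delta_def)
  qed
  then show ?thesis using assms by simp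
qed

section \<open>Products in the tensor algebra and spans in the ideal\<close>

lemma tmul_lin_right: "tmul s (\<lambda>w. x w + k * y w) = (\<lambda>w. tmul s x w + k * tmul s y w)"
  by (simp add: tmul_def fun_eq_iff algebra_simps sum.distrib sum_distrib_left)

lemma tmul_lin_left: "tmul (\<lambda>w. x w + k * y w) s = (\<lambda>w. tmul x s w + k * tmul y s w)"
  by (simp add: tmul_def fun_eq_iff algebra_simps sum.distrib sum_distrib_left)

lemma tmul_tone [simp]: "tmul tone x = x" "tmul x tone = x"
proof -
  have "(if take i w = [] then 1 else 0) * x (drop i w) = (if i = 0 then x w else 0)" if "i \<le> length w" for i w
    using that by auto
  then have "tmul tone x w = (\<Sum>i\<le>length w. if i = 0 then x w else 0)" for w
    unfolding tmul_def tone_def by (intro sum.cong) auto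
  then show "tmul tone x = x" by (simp add: fun_eq_iff)
  have "tmul x tone w = (\<Sum>i\<le>length w. if i = length w then x w else 0)" for w
    unfolding tmul_def tone_def by (intro sum.cong) auto
  then show "tmul x tone = x" by (simp add: fun_eq_iff)
qed

lemma tmul_emb2_left: "tmul (emb2 X) y w = (if 2 \<le> length w then X (w!0) (w!1) * y (drop 2 w) else 0)"
proof -
  have "tmul (emb2 X) y w = (\<Sum>i\<le>length w. if i = 2 then X (w!0) (w!1) * y (drop 2 w) else 0)"
    unfolding tmul_def emb2_def by (intro sum.cong) auto
  then show ?thesis by simp
qed

lemma tmul_emb2_right: "tmul x (emb2 Y) w = (if 2 \<le> length w then
    x (take (length w - 2) w) * Y (w!(length w - 2)) (w!(length w - 1)) else 0)"
proof -
  \<comment> \<open>Only the cut two letters before the end survives. On words shorter than two the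
    subtraction truncates to 0, hence the extra guard.\<close>
  have "tmul x (emb2 Y) w = (\<Sum>i\<le>length w. if i = length w - 2 \<and> 2 \<le> length w then
    x (take (length w - 2) w) * Y (w!(length w - 2)) (w!(length w - 1)) else 0)"
    unfolding tmul_def emb2_def
  proof (intro sum.cong refl)
    fix i assume "i \<in> {..length w}"
    then show "x (take i w) * (if length (drop i w) = 2 then Y (drop i w ! 0) (drop i w ! 1) else 0) =
         (if i = length w - 2 \<and> 2 \<le> length w
          then x (take (length w - 2) w) * Y (w ! (length w - 2)) (w ! (length w - 1)) else 0)"
      by (cases "length w - i = 2") (auto simp: nth_drop numeral_2_eq_2 Suc_diff_Suc)
  qed
  then show ?thesis by auto
qed

lemma mono_simps [simp]: "mono [] = tone" "mono [X] = emb2 X"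
  by (simp_all add: mono_def)

lemma Jideal_lin: "x \<in> Jideal m n G lam \<Longrightarrow> y \<in> Jideal m n G lam \<Longrightarrow> (\<lambda>w. x w + k * y w) \<in> Jideal m n G lam"
  using Jideal.add[OF _ Jideal.smult] .

lemma Jideal_sum: "finite S \<Longrightarrow> (\<And>i. i \<in> S \<Longrightarrow> f i \<in> Jideal m n G lam) \<Longrightarrow> (\<lambda>w. \<Sum>i\<in>S. k i * f i w) \<in> Jideal m n G lam"
proof (induction S rule: finite_induct)
  case empty
  then show ?case by (simp add: Jideal.zero)
next
  case (insert i S)
  then have "(\<lambda>w. (\<Sum>i\<in>S. k i * f i w) + k i * f i w) \<in> Jideal m n G lam"
    by (intro Jideal_lin) auto
  then show ?case using insert by (simp add: add.commute)
qed

section \<open>Spanning elements of \<open>osp\<close> and linear extension of the relations\<close>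

context osp_space begin

definition E :: "nat \<Rightarrow> nat \<Rightarrow> t2" where
  "E a b = (\<lambda>x y. delta a x * delta b y - sg (p a * p b) * (delta b x * delta a y))"

lemma E_osp:
  assumes "a \<in> I" "b \<in> I" shows "E a b \<in> osp m n"
proof -
  have "E a b x y = - sg (p x * p y) * E a b y x" for x y
    by (auto simp: E_def delta_def mult.commute algebra_simps)
  moreover have "supp2 m n (E a b)"
    using assms by (auto simp: supp2_def E_def delta_def)
  ultimately show ?thesis unfolding osp_def by blast
qed

lemma E_swap: "E a b x y = - sg (p a * p b) * E b a x y"
  by (simp add: E_def algebra_simps)

text \<open>The factor 1/2 compensates that \<open>E a b\<close> and \<open>E b a\<close> agree up
  to sign, so that the double sum counts each component twice; for odd \<open>a\<close> the single
  entry of \<open>E a a\<close> is 2.\<close>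

lemma osp_expand:
  assumes "A \<in> osp m n" shows "A x y = (\<Sum>a\<in>I. \<Sum>b\<in>I. A a b / 2 * E a b x y)"
proof (cases "x \<in> I \<and> y \<in> I")
  case True
  have "(\<Sum>a\<in>I. \<Sum>b\<in>I. A a b / 2 * E a b x y)
     = (\<Sum>a\<in>I. \<Sum>b\<in>I. A a b / 2 * (delta a x * delta b y)) - (\<Sum>a\<in>I. \<Sum>b\<in>I. (A a b / 2 * sg (p a * p b)) * (delta a y * delta b x))"
    by (simp add: E_def algebra_simps sum_subtractf)
  also have "\<dots> = A x y / 2 - A y x / 2 * sg (p y * p x)"
    using True by (subst (1 2) sum_delta2) auto
  also have "\<dots> = A x y" using osp_swap[OF assms, of x y] by (simp add: mult.commute)
  finally show ?thesis by simp
next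
  case False
  then have "A x y = 0" using osp_supp[OF assms] by (auto simp: supp2_def)
  moreover have "E a b x y = 0" if "a \<in> I" "b \<in> I" for a b
    using False that by (auto simp: E_def delta_def)
  ultimately show ?thesis by simp
qed

definition bracketT :: "t4 \<Rightarrow> t2" where
  "bracketT T = (\<lambda>a b. trc m n G T a b - sg (p a * p b) * trc m n G T b a)"

lemma bracketT_lin: "bracketT (\<lambda>a b c d. T a b c d + k * U a b c d) x y = bracketT T x y + k * bracketT U x y"
  by (simp add: bracketT_def trc_lin algebra_simps)

definition formT :: "t4 \<Rightarrow> complex" where "formT T = str m n G (trc m n G T)"

lemma formT_lin: "formT (\<lambda>a b c d. T a b c d + k * U a b c d) = formT T + k * formT U"
proof -
  have "trc m n G (\<lambda>a b c d. T a b c d + k * U a b c d) = (\<lambda>a d. trc m n G T a d + k * trc m n G U a d)"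
    by (intro ext trc_lin)
  then show ?thesis by (simp add: formT_def str_lin)
qed

lemma trc_zero [simp]: "trc m n G (\<lambda>a b c d. 0) = (\<lambda>a b. 0)" "str m n G (\<lambda>a b. 0) = 0"
  by (simp_all add: trc_def str_def)

text \<open>The Cartan component is a separate argument, which makes the relation linear in the pair
  of \<open>T\<close> and \<open>W\<close> and avoids reasoning about \<open>cprod1\<close> on
  sums.\<close>

definition relT :: "complex \<Rightarrow> t4 \<Rightarrow> t4 \<Rightarrow> tal" where
  "relT lam T W = (\<lambda>w. emb4 T w - emb4 W w - emb2 (bracketT T) w / 2 - lam * formT T * tone w)"

lemma relT_lin: "relT lam (\<lambda>a b c d. T a b c d + k * T' a b c d) (\<lambda>a b c d. W a b c d + k * W' a b c d)
   = (\<lambda>w. relT lam T W w + k * relT lam T' W' w)"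
  by (simp add: relT_def emb2_def emb4_def formT_lin bracketT_lin fun_eq_iff algebra_simps add_divide_distrib)

text \<open>Two-sided multiples by monomials are built in, since \<open>Jideal\<close> is a span of
  such multiples; later products with elements of \<open>osp\<close> are then immediate.\<close>

definition reduces :: "complex \<Rightarrow> t4 \<Rightarrow> t4 \<Rightarrow> bool" where
  "reduces lam T W \<longleftrightarrow> splits T W \<and> (\<forall>Xs Ys. set Xs \<subseteq> osp m n \<longrightarrow> set Ys \<subseteq> osp m n \<longrightarrow>
     tmul (tmul (mono Xs) (relT lam T W)) (mono Ys) \<in> Jideal m n G lam)"

lemma reduces_lin: "reduces lam T W \<Longrightarrow> reduces lam T' W' \<Longrightarrow>
   reduces lam (\<lambda>a b c d. T a b c d + k * T' a b c d) (\<lambda>a b c d. W a b c d + k * W' a b c d)"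
  unfolding reduces_def relT_lin tmul_lin_left tmul_lin_right
  by (intro conjI splits_lin allI impI Jideal_lin) auto

lemma splits_zero: "T \<in> gwedge m n \<Longrightarrow> S \<in> vsym m n \<Longrightarrow> V \<in> gsym m n \<Longrightarrow>
   splits (\<lambda>a b c d. qmap m n V a b c d + phi m n G S a b c d + T a b c d) (\<lambda>a b c d. 0)"
  unfolding splits_def by (intro conjI bexI[of _ V] bexI[of _ S] bexI[of _ T])
    (simp_all add: cartan1_iff zero_mem qmap_def)

lemma reduces_zero: "reduces lam (\<lambda>a b c d. 0) (\<lambda>a b c d. 0)"
proof -
  have "splits (\<lambda>a b c d. 0) (\<lambda>a b c d. 0)"
    using splits_zero[OF zero_mem(3,4,2)] by (simp add: qmap_def phi_def)
  moreover have "relT lam (\<lambda>a b c d. 0) (\<lambda>a b c d. 0) = (\<lambda>w. 0)"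
    by (simp add: relT_def emb4_def emb2_def bracketT_def formT_def)
  ultimately show ?thesis by (simp add: reduces_def tmul_def Jideal.zero)
qed

lemma reduces_sum: "finite S \<Longrightarrow> (\<And>i. i \<in> S \<Longrightarrow> \<exists>W. reduces lam (f i) W) \<Longrightarrow>
    \<exists>W. reduces lam (\<lambda>a b c d. \<Sum>i\<in>S. k i * f i a b c d) W"
proof (induction S rule: finite_induct)
  case empty
  then show ?case using reduces_zero by auto
next
  case (insert i S)
  then obtain W W' where "reduces lam (\<lambda>a b c d. \<Sum>i\<in>S. k i * f i a b c d) W" "reduces lam (f i) W'" by blast
  from reduces_lin[OF this, of "k i"] show ?case using insert by (auto simp: add.commute)
qed

lemma reduces_tens:
  assumes "X \<in> osp m n" "Y \<in> osp m n" "M \<noteq> 1" "M \<noteq> 2"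
  shows "\<exists>W. reduces lam (tens X Y) W"
proof -
  have "relT lam (tens X Y) (cprod1 m n G X Y) = relgen m n G lam X Y"
    by (simp add: relT_def relgen_def bracket_trc form_trc bracketT_def formT_def)
  then show ?thesis using splits_cprod1[OF assms] assms unfolding reduces_def
    by (intro exI[of _ "cprod1 m n G X Y"]) (auto intro: Jideal.gen)
qed

text \<open>Uniqueness of the Cartan component forces W = 0, which leaves a relation in
  \<open>T\<close> and its lower-order terms alone.\<close>

lemma reduces_relation:
  assumes "reduces lam T W" "splits T (\<lambda>a b c d. 0)" "M \<noteq> 1" "M \<noteq> 2"
    and "set Xs \<subseteq> osp m n" "set Ys \<subseteq> osp m n"
  shows "tmul (tmul (mono Xs) (\<lambda>w. emb4 T w - emb2 (bracketT T) w / 2 - lam * formT T * tone w)) (mono Ys) \<in> Jideal m n G lam"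
proof -
  have "W = (\<lambda>a b c d. 0)" using assms splits_unique unfolding reduces_def by blast
  then have "relT lam T W = (\<lambda>w. emb4 T w - emb2 (bracketT T) w / 2 - lam * formT T * tone w)"
    by (simp add: relT_def emb4_def)
  then show ?thesis using assms unfolding reduces_def by metis
qed

lemma sum_G_delta:
  assumes "i \<in> I" "j \<in> I" shows "(\<Sum>z\<in>I. \<Sum>w\<in>I. G z w * (delta i w * delta j z)) = G j i"
  using sum_delta2[of I j i G] assms
    by (simp add: delta_commute[of i] delta_commute[of j] mult.commute[of "delta _ i"])

lemma str_delta: "a \<in> I \<Longrightarrow> d \<in> I \<Longrightarrow> str m n G (\<lambda>x y. delta a x * delta d y) = G d a"
  by (simp add: str_def sum_G_delta)

lemma trc_tens_E:
  assumes "a \<in> I" "b \<in> I" "c \<in> I" "d \<in> I"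
  shows "trc m n G (tens (E a b) (E c d)) x y = G c b * (delta a x * delta d y)
    - sg (p c * p d) * (G d b * (delta a x * delta c y)) - sg (p a * p b) * (G c a * (delta b x * delta d y))
    + sg (p a * p b) * (sg (p c * p d) * (G d a * (delta b x * delta c y)))"
proof -
  have "trc m n G (tens (E a b) (E c d)) x y = (\<Sum>z\<in>I. \<Sum>w\<in>I.
      (G z w * (delta b w * delta c z)) * (delta a x * delta d y)
    - (G z w * (delta b w * delta d z)) * (sg (p c * p d) * (delta a x * delta c y))
    - (G z w * (delta a w * delta c z)) * (sg (p a * p b) * (delta b x * delta d y))
    + (G z w * (delta a w * delta d z)) * (sg (p a * p b) * (sg (p c * p d) * (delta b x * delta c y))))"
    unfolding trc_def tens_def E_def by (intro sum.cong refl) (simp add: algebra_simps)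
  also have "\<dots> = G c b * (delta a x * delta d y)
    - G d b * (sg (p c * p d) * (delta a x * delta c y))
    - G c a * (sg (p a * p b) * (delta b x * delta d y))
    + G d a * (sg (p a * p b) * (sg (p c * p d) * (delta b x * delta c y)))"
    by (simp only: sum.distrib sum_subtractf flip: sum_distrib_right) (simp only: sum_G_delta assms)
  finally show ?thesis by (simp add: mult_ac)
qed

end

section \<open>The antisymmetriser and the cyclic relation\<close>

definition delta4 :: "nat \<Rightarrow> nat \<Rightarrow> nat \<Rightarrow> nat \<Rightarrow> t4" where
  "delta4 a b c d = (\<lambda>x y z w. delta a x * delta b y * delta c z * delta d w)"

text \<open>\<open>delta4\<close> vanishes unless labels and positions agree, so a sign in the
  labels may be traded for the same sign in the positions.\<close>

lemma delta4_cong: "(a = x \<Longrightarrow> b = y \<Longrightarrow> c = z \<Longrightarrow> d = w \<Longrightarrow> s = s') \<Longrightarrow> s * delta4 a b c d x y z w = s' * delta4 a b c d x y z w"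
  by (auto simp: delta4_def delta_def)

lemma sg_add: "sg (i + j) = sg i * sg j" by (simp add: sg_def power_add)

text \<open>One half of the super-antisymmetriser: the twelve permutations that are left after identifying
those that differ by exchanging the two index pairs.\<close>
definition alt4 :: "nat \<Rightarrow> t4 \<Rightarrow> t4" where
  "alt4 m N = (\<lambda>x y z w. let X = par m x; Y = par m y; Z = par m z; W = par m w in
      N x y z w - sg (X * Y) * N y x z w - sg (Z * W) * N x y w z + sg (X * Y + Z * W) * N y x w z
    + sg (Z * (X + Y)) * N z x y w - sg (Z * (X + Y) + X * Y) * N z y x w
    - sg (W * (X + Y) + W * Z) * N w x y z + sg (W * (X + Y) + X * Y + W * Z) * N w y x z
    - sg (Z * Y) * N x z y w + sg (Z * X + X * Y) * N y z x w
    + sg (W * Y + W * Z) * N x w y z - sg (W * X + X * Y + W * Z) * N y w x z)"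

text \<open>Adding the exchange of pairs restores all 24 permutations, and a transposition of the
  middle positions permutes these up to sign.\<close>

lemma alt4_swap23:
  "alt4 m N x y z w + pair_swap m (alt4 m N) x y z w
     = - sg (par m y * par m z) * (alt4 m N x z y w + pair_swap m (alt4 m N) x z y w)"
  by (cases "x < m"; cases "y < m"; cases "z < m"; cases "w < m"; simp add: alt4_def pair_swap_def)

context osp_space begin

text \<open>This is the cyclic sum over \<open>a\<close>, \<open>b\<close>, \<open>c\<close> only for even \<open>c\<close>: the signs \<open>(-1)^([a][c])\<close> and
\<open>(-1)^([b][c])\<close> are dropped. Even \<open>c\<close> is enough for the final contraction.\<close>
definition cyc4 :: "nat \<Rightarrow> nat \<Rightarrow> nat \<Rightarrow> nat \<Rightarrow> t4" where
  "cyc4 a b c d = (\<lambda>x y z w. (tens (E a b) (E c d) x y z w + sg (p a * p b) * tens (E b c) (E a d) x y z w)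
      + (-1) * tens (E a c) (E b d) x y z w)"

lemma cyc4_alt4:
  assumes "c < m" shows "cyc4 a b c d = alt4 m (delta4 a b c d)"
proof (intro ext)
  fix x y z w
  let ?N = "delta4 a b c d"
  have "cyc4 a b c d x y z w =
      1 * ?N x y z w - sg (p a * p b) * ?N y x z w - sg (p c * p d) * ?N x y w z
        + (sg (p a * p b) * sg (p c * p d)) * ?N y x w z
    + sg (p a * p b) * ?N z x y w - (sg (p a * p b) * sg (p b * p c)) * ?N z y x w
    - (sg (p a * p b) * sg (p a * p d)) * ?N w x y z
        + (sg (p a * p b) * sg (p b * p c) * sg (p a * p d)) * ?N w y x z
    - 1 * ?N x z y w + sg (p a * p c) * ?N y z x w + sg (p b * p d) * ?N x w y z
        - (sg (p a * p c) * sg (p b * p d)) * ?N y w x z"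
    by (simp add: cyc4_def tens_def E_def delta4_def algebra_simps)
  \<comment> \<open>Each of the three products supplies four of the twelve permutations; term by
    term the signs move from labels to positions.\<close>
  also have "\<dots> = alt4 m (delta4 a b c d) x y z w"
    unfolding alt4_def Let_def using assms
    by (intro arg_cong2[of _ _ _ _ "(+)"] arg_cong2[of _ _ _ _ "(-)"] delta4_cong
          delta4_cong[where s=1 and s'=1, simplified])
       (auto simp: algebra_simps sg_add)
  finally show "cyc4 a b c d x y z w = alt4 m (delta4 a b c d) x y z w" .
qed

lemma cyc4_reduces:
  assumes "a \<in> I" "b \<in> I" "c \<in> I" "d \<in> I" "M \<noteq> 1" "M \<noteq> 2"
  shows "\<exists>W. reduces lam (cyc4 a b c d) W"
proof -
  obtain W1 W2 W3 where "reduces lam (tens (E a b) (E c d)) W1" "reduces lam (tens (E b c) (E a d)) W2"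
    "reduces lam (tens (E a c) (E b d)) W3"
    using reduces_tens E_osp assms by metis
  from reduces_lin[OF reduces_lin[OF this(1,2), of "sg (p a * p b)"] this(3), of "-1"]
  show ?thesis unfolding cyc4_def by blast
qed

lemma cyc4_gg:
  assumes "a \<in> I" "b \<in> I" "c \<in> I" "d \<in> I"
  shows "cyc4 a b c d \<in> gg m n"
  unfolding cyc4_def by (intro gg_lin tens_gg E_osp assms)

lemma cyc4_splits:
  assumes "a \<in> I" "b \<in> I" "c \<in> I" "d \<in> I" "c < m"
  shows "splits (cyc4 a b c d) (\<lambda>a b c d. 0)"
proof -
  let ?T = "cyc4 a b c d"
  define Q where "Q = (\<lambda>x y z w. (?T x y z w + pair_swap m ?T x y z w) / 2)"
  define Z where "Z = (\<lambda>x y z w. (?T x y z w - pair_swap m ?T x y z w) / 2)"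
  have Q: "Q \<in> gsym m n" and Z: "Z \<in> gwedge m n"
    unfolding Q_def Z_def by (intro gsym_part cyc4_gg assms)+
  \<comment> \<open>The outer transpositions come from \<open>gsym\<close>, the middle one from the
    full antisymmetriser. So \<open>Q\<close> equals its own \<open>qmap\<close> and needs no Cartan
    or trace part.\<close>
  have "Q x y z w = - sg (p y * p z) * Q x z y w" for x y z w
    unfolding Q_def cyc4_alt4[OF \<open>c < m\<close>] by (subst alt4_swap23) simp
  then have "Q \<in> asym4 m n"
    using gsym_swap(1,2)[OF Q] gg_supp[OF gsym_gg[OF Q]] unfolding asym4_def by blast
  then have "qmap m n Q = Q" by (rule qmap_asym4_id)
  then have "?T = (\<lambda>x y z w. qmap m n Q x y z w + phi m n G (\<lambda>a b. 0) x y z w + Z x y z w)"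
    by (simp add: Q_def Z_def phi_def fun_eq_iff field_simps)
  then show ?thesis using splits_zero[OF Z zero_mem(4) Q] by simp
qed

text \<open>The sign may be read off labels or positions, since these agree wherever the term is
  nonzero. \<open>bracketT\<close> carries its sign in the positions.\<close>

lemma E_position_sign: "E a b x y = delta a x * delta b y - sg (p x * p y) * (delta a y * delta b x)"
  by (auto simp: E_def delta_def mult.commute)

lemma bracketT_tens_E:
  assumes "a \<in> I" "b \<in> I" "c \<in> I" "d \<in> I"
  shows "bracketT (tens (E a b) (E c d)) x y = G c b * E a d x y
    - sg (p c * p d) * (G d b * E a c x y) - sg (p a * p b) * (G c a * E b d x y)
    + sg (p a * p b) * (sg (p c * p d) * (G d a * E b c x y))"
  unfolding bracketT_def trc_tens_E[OF assms] E_position_sign by (simp add: algebra_simps)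

lemma formT_tens_E:
  assumes "a \<in> I" "b \<in> I" "c \<in> I" "d \<in> I"
  shows "formT (tens (E a b) (E c d)) = G c b * G d a
    - sg (p c * p d) * (G d b * G c a) - sg (p a * p b) * (G c a * G d b)
    + sg (p a * p b) * (sg (p c * p d) * (G d a * G c b))"
proof -
  \<comment> \<open>The nested form X + k * Y lets \<open>str_lin\<close> apply repeatedly.\<close>
  have "trc m n G (tens (E a b) (E c d)) = (\<lambda>x y. (((0 + G c b * (delta a x * delta d y))
    + (- sg (p c * p d) * G d b) * (delta a x * delta c y)) + (- sg (p a * p b) * G c a) * (delta b x * delta d y))
    + (sg (p a * p b) * sg (p c * p d) * G d a) * (delta b x * delta c y))"
    by (intro ext) (simp add: trc_tens_E[OF assms])
  then show ?thesis unfolding formT_def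
    by (simp only: str_lin str_delta assms trc_zero) simp
qed

definition cyc2 :: "nat \<Rightarrow> nat \<Rightarrow> nat \<Rightarrow> nat \<Rightarrow> t2" where
  "cyc2 a b c d = (\<lambda>x y. G d c * E a b x y - G d b * E a c x y + sg (p a * p b) * (G d a * E b c x y))"

text \<open>Metric entries among \<open>a\<close>, \<open>b\<close>, \<open>c\<close> cancel between
  the three brackets, while each entry pairing \<open>d\<close> with one of them occurs
  twice.\<close>

lemma bracketT_cyc4:
  assumes "a \<in> I" "b \<in> I" "c \<in> I" "d \<in> I" "c < m"
  shows "bracketT (cyc4 a b c d) x y = 2 * cyc2 a b c d x y"
  unfolding cyc4_def bracketT_lin bracketT_tens_E[OF assms(1-4)] bracketT_tens_E[OF assms(2,3,1,4)]
    bracketT_tens_E[OF assms(1,3,2,4)] cyc2_def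
  using assms(5) G_sym[of b c] G_sym[of a c] G_sym[of b a] G_par[of d a] G_par[of d b] G_par[of d c]
    E_swap[of b a x y] E_swap[of c a x y] E_swap[of c b x y]
  by (cases "a < m"; cases "b < m"; cases "d < m"; simp)

lemma formT_cyc4:
  assumes "a \<in> I" "b \<in> I" "c \<in> I" "d \<in> I" "c < m"
  shows "formT (cyc4 a b c d) = 0"
  unfolding cyc4_def formT_lin formT_tens_E[OF assms(1-4)] formT_tens_E[OF assms(2,3,1,4)]
    formT_tens_E[OF assms(1,3,2,4)]
  using assms(5) G_sym[of b c] G_sym[of a c] G_sym[of b a] G_par[of d a] G_par[of d b] G_par[of d c]
  by (cases "a < m"; cases "b < m"; cases "d < m"; simp)

lemma cyclic_relation:
  assumes "a \<in> I" "b \<in> I" "c \<in> I" "d \<in> I" "c < m" "M \<noteq> 1" "M \<noteq> 2"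
    and "set Xs \<subseteq> osp m n" "set Ys \<subseteq> osp m n"
  shows "tmul (tmul (mono Xs) (\<lambda>w. emb4 (cyc4 a b c d) w - emb2 (cyc2 a b c d) w)) (mono Ys) \<in> Jideal m n G lam"
proof -
  obtain W where W: "reduces lam (cyc4 a b c d) W" using cyc4_reduces assms by metis
  have "(\<lambda>w. emb4 (cyc4 a b c d) w - emb2 (cyc2 a b c d) w) =
     (\<lambda>w. emb4 (cyc4 a b c d) w - emb2 (bracketT (cyc4 a b c d)) w / 2 - lam * formT (cyc4 a b c d) * tone w)"
    using formT_cyc4[OF assms(1-5)] bracketT_cyc4[OF assms(1-5)] by (simp add: emb2_def fun_eq_iff)
  then show ?thesis using reduces_relation[OF W cyc4_splits] assms by simp
qed

section \<open>The contraction relation\<close>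

definition con4 :: "nat \<Rightarrow> nat \<Rightarrow> t4" where
  "con4 c e = (\<lambda>x y z w. \<Sum>d\<in>I. \<Sum>f\<in>I. G d f * tens (E c d) (E f e) x y z w)"

lemma con4_reduces:
  assumes "c \<in> I" "e \<in> I" "M \<noteq> 1" "M \<noteq> 2"
  shows "\<exists>W. reduces lam (con4 c e) W"
proof -
  have "\<exists>W. reduces lam (\<lambda>x y z w. \<Sum>d\<in>I. 1 * (\<Sum>f\<in>I. G d f * tens (E c d) (E f e) x y z w)) W"
    by (intro reduces_sum fin reduces_tens E_osp assms)
  then show ?thesis by (simp add: con4_def)
qed

text \<open>Contracting \<open>d\<close> and \<open>f\<close> turns the inner delta factors into
  metric entries at the positions; the four products are the four terms of
  \<open>phi\<close>.\<close>

lemma con4_phi: "con4 c e = (\<lambda>x y z w. 4 * phi m n G (\<lambda>x y. delta c x * delta e y) x y z w)"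
proof (intro ext)
  fix x y z w
  have "con4 c e x y z w = (\<Sum>d\<in>I. \<Sum>f\<in>I.
      (G d f * (delta c x * delta e w)) * (delta d y * delta f z)
    - (G d f * sg (p f * p e) * (delta c x * delta e z)) * (delta d y * delta f w)
    - (G d f * sg (p c * p d) * (delta c y * delta e w)) * (delta d x * delta f z)
    + (G d f * sg (p c * p d) * sg (p f * p e) * (delta c y * delta e z)) * (delta d x * delta f w))"
    unfolding con4_def tens_def E_def by (simp add: algebra_simps)
  also have "\<dots> = G y z * (delta c x * delta e w) - G y w * sg (p w * p e) * (delta c x * delta e z)
     - G x z * sg (p c * p x) * (delta c y * delta e w) + G x w * sg (p c * p x) * sg (p w * p e) * (delta c y * delta e z)"
    unfolding sum.distrib sum_subtractf
    by (subst (1 2 3 4) sum_delta2) (auto simp: G_supp)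
  also have "\<dots> = 4 * phi m n G (\<lambda>x y. delta c x * delta e y) x y z w"
    unfolding phi_def by (auto simp: delta_def sg_add mult.commute)
  finally show "con4 c e x y z w = 4 * phi m n G (\<lambda>x y. delta c x * delta e y) x y z w" .
qed

lemma delta_supp: "c \<in> I \<Longrightarrow> e \<in> I \<Longrightarrow> supp2 m n (\<lambda>x y. delta c x * delta e y)"
  by (auto simp: supp2_def delta_def)

lemma con4_splits:
  assumes "c \<in> I" "e \<in> I" shows "splits (con4 c e) (\<lambda>a b c d. 0)"
proof -
  \<comment> \<open>\<open>S\<close> and \<open>R\<close> are the symmetric and antisymmetric parts
    of four times the elementary tensor; \<open>phi\<close> sends them to the trace part and the
    wedge part.\<close>
  define S where "S = (\<lambda>x y. 2 * (delta c x * delta e y + sg (p c * p e) * (delta e x * delta c y)))"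
  define R where "R = (\<lambda>x y. 2 * E c e x y)"
  have "S x y = sg (p x * p y) * S y x" for x y
    unfolding S_def by (auto simp: delta_def mult.commute algebra_simps)
  moreover have "supp2 m n S" using assms by (auto simp: S_def delta_def supp2_def)
  ultimately have S: "S \<in> vsym m n" unfolding vsym_def by blast
  have "R x y = - sg (p x * p y) * R y x" for x y
    using osp_swap[OF E_osp[OF assms], of x y] by (simp add: R_def)
  moreover have "supp2 m n R" using osp_supp[OF E_osp[OF assms]] by (simp add: R_def supp2_def)
  ultimately have R: "R \<in> osp m n" unfolding osp_def by blast
  have "con4 c e = (\<lambda>x y z w. qmap m n (\<lambda>a b c d. 0) x y z w + phi m n G S x y z w + phi m n G R x y z w)"
    unfolding con4_phi by (simp add: phi_def qmap_def S_def R_def E_def fun_eq_iff field_simps)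
  then show ?thesis using splits_zero[OF phi_gwedge[OF R] S zero_mem(2)] by simp
qed

lemma trc_con4:
  assumes "c \<in> I" "e \<in> I"
  shows "trc m n G (con4 c e) = (\<lambda>x y. (0 + (M - 2) * (delta c x * delta e y)) + G e c * G x y)"
proof -
  have "con4 c e = (\<lambda>x y z w. 0 + 4 * phi m n G (\<lambda>x y. delta c x * delta e y) x y z w)"
    by (simp add: con4_phi)
  then show ?thesis
    by (intro ext) (simp only: trc_lin trc_phi[OF delta_supp[OF assms]] str_delta[OF assms], simp add: field_simps)
qed

lemma bracketT_con4:
  assumes "c \<in> I" "e \<in> I"
  shows "bracketT (con4 c e) x y = (M - 2) * E c e x y"
proof -
  \<comment> \<open>The summand with G x y is super-symmetric and drops out of the bracket.\<close>
  have g: "sg (p x * p y) * G y x = G x y" using G_sym[of y x] by (simp add: mult.commute)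
  show ?thesis unfolding bracketT_def trc_con4[OF assms] E_position_sign
    using g by (simp add: algebra_simps)
qed

text \<open>The two summands of \<open>trc_con4\<close> have supertraces (M - 2) * G e c and M * G e
  c; this is the source of the factor M - 1.\<close>

lemma formT_con4:
  assumes "c \<in> I" "e \<in> I"
  shows "formT (con4 c e) = 2 * (M - 1) * G e c"
  unfolding formT_def trc_con4[OF assms] str_lin str_G str_delta[OF assms] by (simp add: algebra_simps)

lemma contraction_relation:
  assumes "c \<in> I" "e \<in> I" "M \<noteq> 1" "M \<noteq> 2"
    and "set Xs \<subseteq> osp m n" "set Ys \<subseteq> osp m n"
  shows "tmul (tmul (mono Xs) (\<lambda>w. emb4 (con4 c e) w - (M - 2) / 2 * emb2 (E c e) w
     - 2 * lam * (M - 1) * G e c * tone w)) (mono Ys) \<in> Jideal m n G lam"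
proof -
  obtain W where W: "reduces lam (con4 c e) W" using con4_reduces assms by metis
  have "(\<lambda>w. emb4 (con4 c e) w - (M - 2) / 2 * emb2 (E c e) w - 2 * lam * (M - 1) * G e c * tone w)
     = (\<lambda>w. emb4 (con4 c e) w - emb2 (bracketT (con4 c e)) w / 2 - lam * formT (con4 c e) * tone w)"
    using formT_con4[OF assms(1-2)] bracketT_con4[OF assms(1-2)] by (simp add: emb2_def fun_eq_iff mult_ac)
  then show ?thesis using reduces_relation[OF W con4_splits] assms by simp
qed

section \<open>Combining the two relations\<close>

lemma contract_cyc2:
  assumes "a \<in> I" "b \<in> I" "c \<in> I"
  shows "(\<Sum>d\<in>I. \<Sum>f\<in>I. G d f * (cyc2 a b c d x y * E f e z w))
    = E a b x y * E c e z w - E a c x y * E b e z w + sg (p a * p b) * (E b c x y * E a e z w)"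
proof -
  \<comment> \<open>In \<open>cyc2\<close> the label \<open>d\<close> occurs only in metric factors
    G d i, and orthogonality then replaces \<open>f\<close> by \<open>i\<close>.\<close>
  have c: "(\<Sum>d\<in>I. \<Sum>f\<in>I. G d f * (G d i * E f e z w)) = E i e z w" if i: "i \<in> I" for i
  proof -
    have "(\<Sum>d\<in>I. \<Sum>f\<in>I. G d f * (G d i * E f e z w)) = (\<Sum>f\<in>I. (\<Sum>d\<in>I. G d i * G d f) * E f e z w)"
      by (subst sum.swap) (simp add: sum_distrib_left sum_distrib_right mult_ac)
    also have "\<dots> = (\<Sum>f\<in>I. if f = i then E f e z w else 0)"
      using i by (intro sum.cong) (auto simp: G_orth)
    finally show ?thesis using i by simp
  qed
  have "(\<Sum>d\<in>I. \<Sum>f\<in>I. G d f * (cyc2 a b c d x y * E f e z w)) = (\<Sum>d\<in>I. \<Sum>f\<in>I.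
     E a b x y * (G d f * (G d c * E f e z w)) - E a c x y * (G d f * (G d b * E f e z w))
      + sg (p a * p b) * E b c x y * (G d f * (G d a * E f e z w)))"
    by (intro sum.cong refl) (simp add: cyc2_def algebra_simps)
  then show ?thesis
    by (simp only: sum.distrib sum_subtractf flip: sum_distrib_left) (simp add: c assms)
qed

text \<open>In each product of \<open>cyc4\<close> the label \<open>d\<close> sits at the end of the
  right factor, so contracting it with \<open>E f e\<close> produces \<open>con4\<close>.\<close>

lemma contract_cyc4:
  "(\<Sum>d\<in>I. \<Sum>f\<in>I. G d f * (cyc4 a b c d x y z w * E f e u v))
    = E a b x y * con4 c e z w u v - E a c x y * con4 b e z w u v + sg (p a * p b) * (E b c x y * con4 a e z w u v)"
proof -
  have "(\<Sum>d\<in>I. \<Sum>f\<in>I. G d f * (cyc4 a b c d x y z w * E f e u v)) = (\<Sum>d\<in>I. \<Sum>f\<in>I.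
     E a b x y * (G d f * tens (E c d) (E f e) z w u v) - E a c x y * (G d f * tens (E b d) (E f e) z w u v)
      + (sg (p a * p b) * E b c x y) * (G d f * tens (E a d) (E f e) z w u v))"
    by (intro sum.cong refl) (simp add: cyc4_def tens_def algebra_simps)
  then show ?thesis
    by (simp only: sum.distrib sum_subtractf flip: sum_distrib_left) (simp add: con4_def mult_ac)
qed

lemma cyc2_Jideal:
  assumes ids: "a \<in> I" "b \<in> I" "c \<in> I" "e \<in> I" and c: "c < m" and M: "M \<noteq> 1" "M \<noteq> 2"
    and lam: "4 * lam * (M - 1) \<noteq> 4 - M"
  shows "emb2 (cyc2 a b c e) \<in> Jideal m n G lam"
proof -
  let ?J = "Jideal m n G lam"
  define r1 where "r1 = (\<lambda>d w. emb4 (cyc4 a b c d) w - emb2 (cyc2 a b c d) w)"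
  \<comment> \<open>The coefficient (M - 2) / 2 is split as beta + 1 because the 1 cancels against
    the quadratic terms of \<open>S\<close>.\<close>
  define \<beta> where "\<beta> = (M - 4) / 2"
  define \<alpha> where "\<alpha> = 2 * lam * (M - 1)"
  define r2 where "r2 = (\<lambda>c w. emb4 (con4 c e) w - (\<beta> + 1) * emb2 (E c e) w - \<alpha> * G e c * tone w)"
  have "(M - 2) / 2 = \<beta> + 1" by (simp add: \<beta>_def field_simps)
  note r2_alt = r2_def[folded this, unfolded \<alpha>_def]
  have r1: "r1 e \<in> ?J"
    using cyclic_relation[OF ids c M, of "[]" "[]"] by (simp add: r1_def)
  have r1': "tmul (r1 d) (emb2 (E f e)) \<in> ?J" if "d \<in> I" "f \<in> I" for d f
    using cyclic_relation[OF ids(1-3) that(1) c M, of "[]" "[E f e]"] E_osp[OF that(2) ids(4)] by (simp add: r1_def)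
  have r2: "tmul (emb2 (E i j)) (r2 k) \<in> ?J" if "i \<in> I" "j \<in> I" "k \<in> I" for i j k
    using contraction_relation[OF that(3) ids(4) M, of "[E i j]" "[]"] E_osp[OF that(1,2)] by (simp add: r2_alt)
  define S where "S = (\<lambda>w. \<Sum>d\<in>I. 1 * (\<Sum>f\<in>I. G d f * tmul (r1 d) (emb2 (E f e)) w))"
  have S: "S \<in> ?J" unfolding S_def by (intro Jideal_sum fin r1')
  \<comment> \<open>In degree three the products with \<open>r2\<close> cancel the contracted
    \<open>cyc4\<close>. In degree two \<open>S\<close> gives -1 and the \<open>r2\<close> terms
    give beta + 1 times \<open>cyc4 a b c e\<close>; \<open>r1 e\<close> removes the remaining beta
    and adds beta to the alpha in degree one.\<close>
  define K where "K = (\<lambda>w. (((S w + (-1) * tmul (emb2 (E a b)) (r2 c) w) + tmul (emb2 (E a c)) (r2 b) w)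
     + (- sg (p a * p b)) * tmul (emb2 (E b c)) (r2 a) w) + (- \<beta>) * r1 e w)"
  have K: "K \<in> ?J" unfolding K_def by (intro Jideal_lin Jideal.add S r1 r2 ids)
  have "K w = (\<beta> + \<alpha>) * emb2 (cyc2 a b c e) w" for w
  proof -
    \<comment> \<open>Words of length 6, 4 and 2 carry degrees three, two and one; both sides vanish
      on all others.\<close>
    consider "length w = 6" | "length w = 4" | "length w = 2" | "length w \<notin> {2,4,6}"
      by blast
    then show ?thesis
    proof cases
      case 1
      then obtain x y z u v t where w: "w = [x,y,z,u,v,t]"
        by (auto simp: length_Suc_conv eval_nat_numeral)
      have "S w = (\<Sum>d\<in>I. \<Sum>f\<in>I. G d f * (cyc4 a b c d x y z u * E f e v t))"
        unfolding S_def w tmul_emb2_right by (simp add: r1_def emb4_def emb2_def eval_nat_numeral)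
      then have "S w = E a b x y * con4 c e z u v t - E a c x y * con4 b e z u v t + sg (p a * p b) * (E b c x y * con4 a e z u v t)"
        by (simp only: contract_cyc4)
      then show ?thesis
        unfolding K_def w tmul_emb2_left by (simp add: r1_def r2_def emb4_def emb2_def tone_def eval_nat_numeral)
    next
      case 2
      then obtain x y z u where w: "w = [x,y,z,u]"
        by (auto simp: length_Suc_conv eval_nat_numeral)
      have "S w = (\<Sum>d\<in>I. \<Sum>f\<in>I. - (G d f * (cyc2 a b c d x y * E f e z u)))"
        unfolding S_def w tmul_emb2_right by (simp add: r1_def emb4_def emb2_def eval_nat_numeral)
      then have "S w = - (E a b x y * E c e z u - E a c x y * E b e z u + sg (p a * p b) * (E b c x y * E a e z u))"
        by (simp only: sum_negf contract_cyc2[OF ids(1-3)])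
      then show ?thesis
        unfolding K_def w tmul_emb2_left by (simp add: r1_def r2_def emb4_def emb2_def tone_def cyc4_def tens_def algebra_simps)
    next
      case 3
      then obtain x y where w: "w = [x,y]"
        by (auto simp: length_Suc_conv eval_nat_numeral)
      have "S w = 0"
        unfolding S_def w tmul_emb2_right by (simp add: r1_def emb4_def emb2_def eval_nat_numeral)
      then show ?thesis
        unfolding K_def w tmul_emb2_left by (simp add: r1_def r2_def emb4_def emb2_def tone_def cyc2_def algebra_simps)
    next
      case 4
      then have "r1 e w = 0" "\<And>d. 2 \<le> length w \<Longrightarrow> r1 d (take (length w - 2) w) = 0"
        "\<And>c. 2 \<le> length w \<Longrightarrow> r2 c (drop 2 w) = 0" "emb2 (cyc2 a b c e) w = 0"
        by (auto simp: r1_def r2_def emb4_def emb2_def tone_def)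
      then show ?thesis unfolding K_def S_def tmul_emb2_left tmul_emb2_right by simp
    qed
  qed
  then have "K = (\<lambda>w. (\<beta> + \<alpha>) * emb2 (cyc2 a b c e) w)" by blast
  then have "(\<lambda>w. inverse (\<beta> + \<alpha>) * ((\<beta> + \<alpha>) * emb2 (cyc2 a b c e) w)) \<in> ?J"
    using Jideal.smult[OF K] by simp
  \<comment> \<open>Twice this scalar is M - 4 + 4 * lam * (M - 1), so it vanishes only at the
    excluded value.\<close>
  moreover have "\<beta> + \<alpha> \<noteq> 0"
  proof
    assume "\<beta> + \<alpha> = 0"
    then have "(M - 4) / 2 + 2 * lam * (M - 1) = 0" by (simp only: \<alpha>_def \<beta>_def)
    then have "4 * lam * (M - 1) = 4 - M" by algebra
    with lam show False ..
  qed
  ultimately show ?thesis by (simp flip: mult.assoc)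
qed

text \<open>Contracting over the even \<open>c\<close> only gives a factor between \<open>m - 2\<close> and \<open>m\<close> instead of \<open>M - 2\<close>.\<close>
lemma E_Jideal:
  assumes ids: "a \<in> I" "b \<in> I" and M: "M \<noteq> 1" "M \<noteq> 2" and m: "m > 2"
    and lam: "4 * lam * (M - 1) \<noteq> 4 - M"
  shows "emb2 (E a b) \<in> Jideal m n G lam"
proof -
  let ?J = "Jideal m n G lam"
  define S where "S = (\<lambda>w. \<Sum>c<m. 1 * (\<Sum>e\<in>I. G e c * emb2 (cyc2 a b c e) w))"
  have c_in: "c \<in> I" if "c < m" for c using that by (simp add: idx_def)
  have S: "S \<in> ?J" unfolding S_def by (intro Jideal_sum fin finite_lessThan cyc2_Jideal[OF ids c_in _ _ M lam]) auto
  \<comment> \<open>The summands c = a and c = b, present only for even labels, each remove one copy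
    of \<open>E a b\<close>. What is left is a positive natural number since m > 2.\<close>
  define k :: complex where "k = of_nat m - (if b < m then 1 else 0) - (if a < m then 1 else 0)"
  have "k \<noteq> 0"
  proof -
    define j where "j = m - (if b < m then 1 else 0) - (if a < m then 1 else 0)"
    have "k = of_nat j" using m by (auto simp: k_def j_def of_nat_diff)
    moreover have "j > 0" using m by (auto simp: j_def)
    ultimately show ?thesis by simp
  qed
  have "(\<Sum>c<m. \<Sum>e\<in>I. G e c * cyc2 a b c e x y) = k * E a b x y" for x y
  proof -
    have "(\<Sum>e\<in>I. G e c * cyc2 a b c e x y) = E a b x y - (if c = b then E a b x y else 0)
        - (if c = a then E a b x y else 0)" if "c < m" for c
    proof -
      have "(\<Sum>e\<in>I. G e c * cyc2 a b c e x y) = (\<Sum>e\<in>I. G e c * G e c * E a b x y - G e c * G e b * E a c x y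
          + G e c * G e a * (sg (p a * p b) * E b c x y))"
        by (intro sum.cong refl) (simp add: cyc2_def algebra_simps)
      also have "\<dots> = E a b x y - (if b = c then 1 else 0) * E a c x y
          + (if a = c then 1 else 0) * (sg (p a * p b) * E b c x y)"
        by (simp only: sum.distrib sum_subtractf flip: sum_distrib_right) (simp add: G_orth ids c_in that)
      also have "\<dots> = E a b x y - (if c = b then E a b x y else 0) - (if c = a then E a b x y else 0)"
      proof -
        have "sg (p a * p b) * E b a x y = - E a b x y" by (subst E_swap[of a b]) simp
        then show ?thesis by simp
      qed
      finally show ?thesis .
    qed
    then have "(\<Sum>c<m. \<Sum>e\<in>I. G e c * cyc2 a b c e x y) = (\<Sum>c<m. E a b x y - (if c = b then E a b x y else 0)
        - (if c = a then E a b x y else 0))" by (intro sum.cong) auto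
    also have "\<dots> = k * E a b x y"
      unfolding sum_subtractf by (simp add: k_def left_diff_distrib)
    finally show ?thesis .
  qed
  then have "S = (\<lambda>w. k * emb2 (E a b) w)"
    by (auto simp: S_def emb2_def fun_eq_iff)
  then have "(\<lambda>w. inverse k * (k * emb2 (E a b) w)) \<in> ?J" using Jideal.smult[OF S] by simp
  then show ?thesis using \<open>k \<noteq> 0\<close> by (simp flip: mult.assoc)
qed

end

theorem theorem5p2:
  fixes m n :: nat and G :: t2 and lam :: complex and A :: t2
  assumes "m > 4" and "n > 1"
    and "osp_metric m n G"
    and "int m - 2 * int n \<notin> {1, 2}"
    and "lam \<noteq> - (of_int (int m - 2 * int n) - 4) / (4 * (of_int (int m - 2 * int n) - 1))"
    and "A \<in> osp m n"
  shows "emb2 A \<in> Jideal m n G lam"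
proof -
  interpret osp_space m n G by standard fact
  have Mi: "M = of_int (int m - 2 * int n)" by simp
  have M: "M \<noteq> 1" "M \<noteq> 2"
    using assms(4) unfolding Mi by (simp_all only: of_int_eq_1_iff of_int_eq_numeral_iff insert_iff not_False_eq_True de_Morgan_disj)
  \<comment> \<open>The hypothesis on \<open>lam\<close>, multiplied by the denominator 4 * (M - 1),
    which is nonzero because \<open>M\<close> differs from 1.\<close>
  have lam: "4 * lam * (M - 1) \<noteq> 4 - M"
  proof
    assume h: "4 * lam * (M - 1) = 4 - M"
    have "lam = - (M - 4) / (4 * (M - 1))"
    proof (rule nonzero_eq_divide_eq[THEN iffD2])
      show "4 * (M - 1) \<noteq> 0" using M(1) by (metis mult_eq_0_iff right_minus_eq zero_neq_numeral)
      show "lam * (4 * (M - 1)) = - (M - 4)" using h by (simp only: mult_ac minus_diff_eq)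
    qed
    then show False using assms(5) unfolding Mi by blast
  qed
  have "(\<lambda>w. \<Sum>a\<in>I. 1 * (\<Sum>b\<in>I. A a b / 2 * emb2 (E a b) w)) \<in> Jideal m n G lam"
    using assms(1) by (intro Jideal_sum fin E_Jideal M lam) auto
  also have "(\<lambda>w. \<Sum>a\<in>I. 1 * (\<Sum>b\<in>I. A a b / 2 * emb2 (E a b) w)) = emb2 A"
  proof
    fix w
    show "(\<Sum>a\<in>I. 1 * (\<Sum>b\<in>I. A a b / 2 * emb2 (E a b) w)) = emb2 A w"
      by (cases "length w = 2") (simp_all add: emb2_def flip: osp_expand[OF assms(6)] times_divide_eq_left)
  qed
  finally show ?thesis .
qed

end
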